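(* Let $p$ be a prime, let $G$ be a finite $p$-group, and let $n$ be a non-negative integer such that $|G'| > p^{n(n-1)/2}$. Then $G$ is generated by the set of elements $x \in G$ with $b(x) \geq n$.
   Context: $G'$ denotes the derived (commutator) subgroup of $G$. For $x$ in a finite $p$-group $G$, the breadth $b(x)$ is defined by $|G : C_G(x)| = p^{b(x)}$, where $C_G(x)$ is the centralizer of $x$ in $G$. *)

theory Defs
  imports "HOL-Algebra.Algebra"
begin

definition centralizer :: "('a, 'b) monoid_scheme \<Rightarrow> 'a \<Rightarrow> 'a set" where
  "centralizer G x = {y \<in> carrier G. y \<otimes>\<^bsub>G\<^esub> x = x \<otimes>\<^bsub>G\<^esub> y}"

definition breadth :: "('a, 'b) monoid_scheme \<Rightarrow> nat \<Rightarrow> 'a \<Rightarrow> nat" where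
  "breadth G p x = (THE b. card (carrier G) = p ^ b * card (centralizer G x))"

end

theory Submission
  imports Defs
begin

text \<open>
  It suffices to show \<open>P(m)\<close>: if all elements outside a proper subgroup \<open>M\<close>, which may be taken
  maximal, have breadth at most \<open>m\<close>, then \<open>|G'| \<le> p ^ (m(m+1)/2)\<close>. The proof is by strong induction
  on \<open>m\<close>.

  Suppose there are \<open>y\<close> outside \<open>M\<close> and a noncentral \<open>u\<close> in the second center with \<open>C(y) \<le> C(u)\<close>. Let
  \<open>L \<ge> C(u)\<close> be maximal and let \<open>K\<close> be a third maximal subgroup containing \<open>L \<inter> M\<close>. Let \<open>S\<close> be the set
  of elements of \<open>K\<close> that are central modulo \<open>K'\<close>, and let \<open>N = [u, S]\<close>, a central subgroup inside
  \<open>K'\<close>. No element of \<open>K - M\<close> commutes with \<open>u\<close>, so these elements have breadth at most \<open>m - 1\<close> in \<open>K/N\<close>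
  and \<open>P(m-1)\<close> bounds \<open>|K'/N|\<close>; moreover \<open>|G' : K'| \<le> |K : S|\<close> and
  \<open>|K : S| |N| = |K : S| |S : C_S(u)| \<le> |G : C(y)| \<le> p ^ m\<close>.

  To find \<open>y\<close> and \<open>u\<close>, start with any noncentral \<open>u\<close> in the second center, let \<open>B = [u, G]\<close>, and let \<open>p ^ b\<close>
  be the largest class size in \<open>G/B\<close> of an element \<open>x\<close> outside \<open>M\<close>. If \<open>u\<close> lies in \<open>M\<close>, comparing \<open>C(x)\<close>
  with \<open>C(x u)\<close> shows that \<open>C(u)\<close> contains a subgroup of index at most \<open>p ^ (2m-b)\<close>. Then either
  \<open>C(x) \<le> C(u)\<close>, or \<open>C(u) \<le> C(x)\<close>, in which case \<open>C(x)\<close> is normal and \<open>u\<close> can be replaced by an element of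
  \<open>C(C(x))\<close>, or \<open>|B|\<close> is so small that \<open>P(b)\<close> for \<open>G/B\<close> already gives the bound.
\<close>

section \<open>Finite groups\<close>

lemma card_eq_card_fibre_times_card_image:
  assumes "finite A" and "\<And>a. a \<in> A \<Longrightarrow> card {b \<in> A. f b = f a} = c"
  shows "card A = c * card (f ` A)"
proof -
  have "card A = (\<Sum>y\<in>f ` A. card {b \<in> A. f b = y})"
    using sum.image_gen[OF assms(1), of "\<lambda>_. 1 :: nat" f] by simp
  also have "\<dots> = (\<Sum>y\<in>f ` A. c)"
    by (rule sum.cong) (use assms(2) in auto)
  finally show ?thesis by simp
qed

definition center :: "('a, 'b) monoid_scheme \<Rightarrow> 'a set" where
  "center G = {z \<in> carrier G. \<forall>g \<in> carrier G. z \<otimes>\<^bsub>G\<^esub> g = g \<otimes>\<^bsub>G\<^esub> z}"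

lemma center_closed: "z \<in> center G \<Longrightarrow> z \<in> carrier G"
  by (simp add: center_def)

lemma center_commute: "\<lbrakk>z \<in> center G; g \<in> carrier G\<rbrakk> \<Longrightarrow> z \<otimes>\<^bsub>G\<^esub> g = g \<otimes>\<^bsub>G\<^esub> z"
  by (simp add: center_def)

definition commutator :: "('a, 'b) monoid_scheme \<Rightarrow> 'a \<Rightarrow> 'a \<Rightarrow> 'a" where
  "commutator G x y = x \<otimes>\<^bsub>G\<^esub> y \<otimes>\<^bsub>G\<^esub> inv\<^bsub>G\<^esub> x \<otimes>\<^bsub>G\<^esub> inv\<^bsub>G\<^esub> y"

context group
begin

text \<open>The map \<open>f\<close> need not be a homomorphism; it suffices that its fibres on
  \<open>S\<close> are the left cosets of \<open>C\<close>. The intended maps send an element to its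
  commutator with a fixed one.\<close>

lemma card_subgroup_eq_card_fibre_times_card_image:
  assumes fin: "finite (carrier G)" and S: "subgroup S G" and C: "subgroup C G" "C \<subseteq> S"
    and f: "\<And>x y. x \<in> S \<Longrightarrow> y \<in> S \<Longrightarrow> f x = f y \<longleftrightarrow> inv x \<otimes> y \<in> C"
  shows "card S = card C * card (f ` S)"
proof (rule card_eq_card_fibre_times_card_image)
  show "finite S" using fin S finite_subset subgroup.subset by blast
  fix a assume a: "a \<in> S"
  have aG: "a \<in> carrier G" using subgroup.mem_carrier[OF S a] .
  have "{b \<in> S. f b = f a} = (\<lambda>c. a \<otimes> c) ` C"
  proof (intro equalityI subsetI)
    fix b assume b: "b \<in> {b \<in> S. f b = f a}"
    then have "inv a \<otimes> b \<in> C" using f[OF a, of b] by auto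
    moreover have "b = a \<otimes> (inv a \<otimes> b)"
      using b aG subgroup.mem_carrier[OF S, of b] by (simp add: m_assoc[symmetric])
    ultimately show "b \<in> (\<lambda>c. a \<otimes> c) ` C" by blast
  next
    fix b assume "b \<in> (\<lambda>c. a \<otimes> c) ` C"
    then obtain c where c: "c \<in> C" "b = a \<otimes> c" by blast
    have cG: "c \<in> carrier G" using subgroup.mem_carrier[OF C(1) c(1)] .
    have "inv a \<otimes> b = c" using c aG cG by (simp add: m_assoc[symmetric])
    moreover have "b \<in> S" using subgroup.m_closed[OF S a, of c] c C(2) by auto
    ultimately show "b \<in> {b \<in> S. f b = f a}" using f[OF a, of b] c by auto
  qed
  moreover have "inj_on (\<lambda>c. a \<otimes> c) C"
    using aG subgroup.mem_carrier[OF C(1)] by (intro inj_onI) auto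
  ultimately show "card {b \<in> S. f b = f a} = card C" by (simp add: card_image)
qed

text \<open>The map (h, k) to h k^-1 has its image inside \<open>P\<close>, and its fibres are the
  orbits of the intersection acting by simultaneous right multiplication. The image need not be a
  subgroup.\<close>

lemma card_mult_le_card_Int_subgroups:
  assumes fin: "finite (carrier G)" and H: "subgroup H G" and K: "subgroup K G"
    and P: "subgroup P G" and "H \<subseteq> P" "K \<subseteq> P"
  shows "card H * card K \<le> card P * card (H \<inter> K)"
proof -
  have fH: "finite H" "finite K" "finite P"
    using fin H K P finite_subset subgroup.subset by blast+
  let ?f = "\<lambda>(h, k). h \<otimes> inv k"
  have mem: "\<And>x. x \<in> H \<Longrightarrow> x \<in> carrier G" "\<And>x. x \<in> K \<Longrightarrow> x \<in> carrier G"
    using subgroup.mem_carrier[OF H] subgroup.mem_carrier[OF K] by simp_all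
  have "card (H \<times> K) = card (H \<inter> K) * card (?f ` (H \<times> K))"
  proof (rule card_eq_card_fibre_times_card_image)
    show "finite (H \<times> K)" using fH by simp
    fix a assume "a \<in> H \<times> K"
    then obtain h k where a: "a = (h, k)" "h \<in> H" "k \<in> K" by auto
    have hk: "h \<in> carrier G" "k \<in> carrier G" using a mem by auto
    have "{b \<in> H \<times> K. ?f b = ?f a} = (\<lambda>d. (h \<otimes> d, k \<otimes> d)) ` (H \<inter> K)"
    proof (intro equalityI subsetI)
      fix b assume "b \<in> {b \<in> H \<times> K. ?f b = ?f a}"
      then obtain h' k' where b: "b = (h', k')" "h' \<in> H" "k' \<in> K" "h' \<otimes> inv k' = h \<otimes> inv k"
        using a by auto
      have hk': "h' \<in> carrier G" "k' \<in> carrier G" using b mem by auto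
      have "h' = h \<otimes> inv k \<otimes> k'" using b(4) hk hk' by (metis inv_solve_right inv_closed m_closed)
      then have "inv h \<otimes> h' = inv k \<otimes> k'"
        using hk hk' by (metis inv_closed inv_solve_left m_assoc m_closed)
      moreover have "inv h \<otimes> h' \<in> H" "inv k \<otimes> k' \<in> K"
        using a b H K by (simp_all add: subgroup.m_closed subgroup.m_inv_closed)
      moreover have "h' = h \<otimes> (inv h \<otimes> h')" "k' = k \<otimes> (inv k \<otimes> k')"
        using hk hk' by (simp_all add: m_assoc[symmetric])
      ultimately show "b \<in> (\<lambda>d. (h \<otimes> d, k \<otimes> d)) ` (H \<inter> K)"
        using b(1) by (intro image_eqI[of _ _ "inv h \<otimes> h'"]) auto
    next
      fix b assume "b \<in> (\<lambda>d. (h \<otimes> d, k \<otimes> d)) ` (H \<inter> K)"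
      then obtain d where d: "d \<in> H" "d \<in> K" "b = (h \<otimes> d, k \<otimes> d)" by auto
      have "d \<otimes> (inv d \<otimes> inv k) = inv k"
        using hk mem(1)[OF d(1)] by (simp add: m_assoc[symmetric])
      then have "h \<otimes> d \<otimes> inv (k \<otimes> d) = h \<otimes> inv k"
        using hk mem(1)[OF d(1)] by (simp add: inv_mult_group m_assoc)
      then show "b \<in> {b \<in> H \<times> K. ?f b = ?f a}"
        using a d hk mem(1)[OF d(1)] H K by (auto intro: subgroup.m_closed)
    qed
    moreover have "inj_on (\<lambda>d. (h \<otimes> d, k \<otimes> d)) (H \<inter> K)"
      using hk mem by (intro inj_onI) auto
    ultimately show "card {b \<in> H \<times> K. ?f b = ?f a} = card (H \<inter> K)" by (simp add: card_image)
  qed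
  moreover have "?f ` (H \<times> K) \<subseteq> P"
    using assms by (auto intro!: subgroup.m_closed[OF P] subgroup.m_inv_closed[OF P])
  then have "card (?f ` (H \<times> K)) \<le> card P" using fH card_mono by blast
  ultimately show ?thesis by (simp add: card_cartesian_product mult.commute)
qed

text \<open>The quotient lives on coset representatives, so that inductions over all groups on a fixed
  type can pass to it.\<close>

lemma quotient_on_representatives:
  assumes "N \<lhd> G"
  obtains Q :: "'a monoid" and h where "group_hom G Q h" "h ` carrier G = carrier Q" "kernel G Q h = N"
proof -
  interpret N: normal N G by fact
  define h where "h x = (SOME y. y \<in> N #> x)" for x
  have h: "h x \<in> N #> x" if "x \<in> carrier G" for x
    unfolding h_def using that rcos_self[OF _ N.subgroup_axioms] by (rule_tac someI) auto
  have hG: "h x \<in> carrier G" if "x \<in> carrier G" for x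
    using h[OF that] r_coset_subset_G[OF N.subset that] by blast
  have coset: "N #> h x = N #> x" if "x \<in> carrier G" for x
    using repr_independence[OF h[OF that] that N.subgroup_axioms] by simp
  have heq: "h x = h y \<longleftrightarrow> N #> x = N #> y" if "x \<in> carrier G" "y \<in> carrier G" for x y
    using coset that by (metis h_def)
  \<comment> \<open>\<open>H\<close> need not be a group on the whole type. It only carries the
    multiplication, and \<open>hom_imp_img_group\<close> supplies the group axioms on the image of
    \<open>h\<close>.\<close>
  define H :: "'a monoid" where "H = \<lparr>carrier = UNIV, monoid.mult = \<lambda>x y. h (x \<otimes> y), one = \<one>\<rparr>"
  have hmult: "h (x \<otimes> y) = h (h x \<otimes> h y)" if "x \<in> carrier G" "y \<in> carrier G" for x y
  proof -
    have "N #> (h x \<otimes> h y) = N #> (x \<otimes> y)"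
      using N.rcos_sum[OF that] N.rcos_sum[OF hG[OF that(1)] hG[OF that(2)]] that coset by simp
    then show ?thesis using that hG heq[of "x \<otimes> y" "h x \<otimes> h y"] by simp
  qed
  have hom: "h \<in> hom G H"
    using hmult by (auto simp: hom_def H_def)
  define Q where "Q = H\<lparr>carrier := h ` carrier G, one := h \<one>\<rparr>"
  have "group Q" unfolding Q_def using hom_imp_img_group[OF hom] by simp
  then have gh: "group_hom G Q h"
    using hom is_group by (auto simp: group_hom_def group_hom_axioms_def hom_def H_def Q_def)
  have "kernel G Q h = N"
  proof -
    have "h x = h \<one> \<longleftrightarrow> x \<in> N" if "x \<in> carrier G" for x
      using that heq[OF that one_closed]
      by (metis N.subgroup_axioms N.subset coset_join1 coset_join2 coset_mult_one subset_iff one_closed)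
    moreover have "N \<subseteq> carrier G" by (rule N.subset)
    ultimately show ?thesis by (auto simp: kernel_def Q_def)
  qed
  then show ?thesis using that[OF gh] by (simp add: Q_def)
qed

end

lemma (in group_hom) card_vimage:
  assumes fin: "finite (carrier G)" and surj: "h ` carrier G = carrier H" and S: "S \<subseteq> carrier H"
  shows "card {g \<in> carrier G. h g \<in> S} = card (kernel G H h) * card S"
proof -
  let ?A = "{g \<in> carrier G. h g \<in> S}"
  have "h ` ?A = S"
  proof -
    have "y \<in> h ` ?A" if "y \<in> S" for y
    proof -
      have "y \<in> h ` carrier G" using S surj that by auto
      then show ?thesis using that by auto
    qed
    then show ?thesis by auto
  qed
  moreover have "card ?A = card (kernel G H h) * card (h ` ?A)"
  proof (rule card_eq_card_fibre_times_card_image)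
    show "finite ?A" using fin by simp
    fix a assume a: "a \<in> ?A"
    have "{b \<in> ?A. h b = h a} = (\<lambda>c. a \<otimes> c) ` kernel G H h"
    proof (intro equalityI subsetI)
      fix b assume b: "b \<in> {b \<in> ?A. h b = h a}"
      then have "inv a \<otimes> b \<in> kernel G H h" using a by (simp add: kernel_def)
      moreover have "b = a \<otimes> (inv a \<otimes> b)" using a b by (simp add: G.m_assoc[symmetric])
      ultimately show "b \<in> (\<lambda>c. a \<otimes> c) ` kernel G H h" by blast
    qed (use a in \<open>auto simp: kernel_def\<close>)
    moreover have "inj_on (\<lambda>c. a \<otimes> c) (kernel G H h)"
      using a by (intro inj_onI) (auto simp: kernel_def)
    ultimately show "card {b \<in> ?A. h b = h a} = card (kernel G H h)" by (simp add: card_image)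
  qed
  ultimately show ?thesis by simp
qed

section \<open>Finite \<open>p\<close>-groups\<close>

locale finite_p_group = group G for G (structure) +
  fixes p :: nat
  assumes prime_p: "Factorial_Ring.prime p"
    and fin: "finite (carrier G)"
    and card_power: "\<exists>k. card (carrier G) = p ^ k"
begin

lemma card_subgroup_power:
  assumes "subgroup H G"
  obtains k where "card H = p ^ k"
proof -
  have "card H dvd card (carrier G)"
    using lagrange[OF assms] by (metis dvd_triv_right order_def)
  then show ?thesis
    using that card_power divides_primepow_nat[OF prime_p] by auto
qed

lemma finite_subgroup: "subgroup H G \<Longrightarrow> finite H"
  using fin finite_subset subgroup.subset by metis

lemma card_subgroup_pos: "subgroup H G \<Longrightarrow> 0 < card H"
  using finite_subgroup[of H] subgroup.one_closed[of H G] by (auto simp: card_gt_0_iff)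

lemma card_proper_subgroup:
  assumes H: "subgroup H G" and K: "subgroup K G" and "H \<subset> K"
  shows "p * card H \<le> card K"
proof -
  obtain a b where ab: "card H = p ^ a" "card K = p ^ b"
    using card_subgroup_power[OF H] card_subgroup_power[OF K] by metis
  have "card H < card K" using psubset_card_mono[OF finite_subgroup[OF K]] assms by simp
  then have "a < b"
    using ab prime_gt_1_nat[OF prime_p] by simp
  then have "p ^ Suc a \<le> p ^ b"
    using prime_gt_1_nat[OF prime_p] by (intro power_increasing) auto
  then show ?thesis using ab by simp
qed

lemma subgroup_is_p_group:
  assumes "subgroup H G"
  shows "finite_p_group (G\<lparr>carrier := H\<rparr>) p"
proof -
  obtain k where "card H = p ^ k" by (rule card_subgroup_power[OF assms])
  then show ?thesis
    using subgroup_imp_group[OF assms] prime_p finite_subgroup[OF assms]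
    by (auto simp: finite_p_group_def finite_p_group_axioms_def)
qed

lemma surjective_image_is_p_group:
  assumes "group_hom G Q h" and surj: "h ` carrier G = carrier Q"
  shows "finite_p_group Q p"
proof -
  interpret h: group_hom G Q h by fact
  have "{g \<in> carrier G. h g \<in> carrier Q} = carrier G" using h.hom_closed by auto
  then have "card (carrier G) = card (kernel G Q h) * card (carrier Q)"
    using h.card_vimage[OF fin surj subset_refl] by simp
  then have "card (carrier Q) dvd card (carrier G)" by simp
  then have "\<exists>k. card (carrier Q) = p ^ k"
    using card_power divides_primepow_nat[OF prime_p] by auto
  moreover have "finite (carrier Q)" using surj fin by (metis finite_imageI)
  ultimately show ?thesis
    using prime_p h.H.is_group by (simp add: finite_p_group_def finite_p_group_axioms_def)
qed

text \<open>Class equation: \<open>N\<close> is a union of conjugacy classes, and those of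
  noncentral elements have size divisible by \<open>p\<close>. Since \<open>p\<close> divides |N|,
  the class of the identity cannot be the only central one in \<open>N\<close>.\<close>

lemma normal_subgroup_meets_center:
  assumes N: "N \<lhd> G" and nontriv: "N \<noteq> {\<one>}"
  obtains z where "z \<in> N" "z \<noteq> \<one>" "z \<in> center G"
proof (rule ccontr)
  assume "\<not> thesis"
  with that have triv: "z = \<one>" if "z \<in> N" "z \<in> center G" for z
    using \<open>z \<in> N\<close> \<open>z \<in> center G\<close> by blast
  let ?c = "\<lambda>g. \<lambda>h \<in> carrier G. g \<otimes> h \<otimes> inv g"
  interpret c: group_action G "carrier G" ?c by (rule action_by_conjugation)
  have NG: "subgroup N G" using N by (rule normal_imp_subgroup)
  have sub: "N \<subseteq> carrier G" using NG by (rule subgroup.subset)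
  have orb: "orbit G ?c x = (\<lambda>g. g \<otimes> x \<otimes> inv g) ` carrier G" if "x \<in> carrier G" for x
    using that by (auto simp: orbit_def)
  have inN: "y \<in> N \<longleftrightarrow> x \<in> N" if "x \<in> carrier G" "y \<in> orbit G ?c x" for x y
  proof -
    have "y \<in> (\<lambda>g. g \<otimes> x \<otimes> inv g) ` carrier G" using that(2) orb[OF that(1)] by simp
    then obtain g where g: "g \<in> carrier G" "y = g \<otimes> x \<otimes> inv g" by blast
    have "x = inv g \<otimes> y \<otimes> inv (inv g)"
      using g that by (simp add: m_assoc) (simp add: m_assoc[symmetric])
    moreover have "y \<in> N \<Longrightarrow> inv g \<otimes> y \<otimes> inv (inv g) \<in> N"
      using normal_invE(2)[OF N, of "inv g" y] g by simp
    moreover have "x \<in> N \<Longrightarrow> y \<in> N" using normal_invE(2)[OF N, of g x] g by simp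
    ultimately show ?thesis by metis
  qed
  \<comment> \<open>Summing the indicator function of \<open>N\<close> over all classes of
    \<open>G\<close> replaces an action on \<open>N\<close> itself.\<close>
  define f :: "'a \<Rightarrow> nat" where "f x = of_bool (x \<in> N)" for x
  have "card N = (\<Sum>x\<in>carrier G. f x)"
    using fin sub by (simp add: f_def sum.If_cases of_bool_def Int_absorb1 flip: Collect_mem_eq)
  also have "\<dots> = (\<Sum>orb\<in>orbits G (carrier G) ?c. \<Sum>x\<in>orb. f x)"
    using c.disjoint_sum[OF fin, of f] by simp
  finally have cardN: "card N = (\<Sum>orb\<in>orbits G (carrier G) ?c. \<Sum>x\<in>orb. f x)" .
  have orb1: "orbit G ?c \<one> = {\<one>}"
    using orb[OF one_closed] one_closed by auto
  have mem1: "{\<one>} \<in> orbits G (carrier G) ?c"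
    unfolding orbits_def using orb1 by (metis (mono_tags, lifting) mem_Collect_eq one_closed)
  have fino: "finite (orbits G (carrier G) ?c)"
  proof (rule finite_UnionD)
    show "finite (\<Union> (orbits G (carrier G) ?c))" unfolding c.orbits_coverture by (rule fin)
  qed
  have dvd: "p dvd (\<Sum>x\<in>orb. f x)" if o: "orb \<in> orbits G (carrier G) ?c - {{\<one>}}" for orb
  proof -
    obtain x where x: "x \<in> carrier G" "orb = orbit G ?c x" "orb \<noteq> {\<one>}"
      using o by (auto simp: orbits_def)
    have "(\<Sum>y\<in>orb. f y) = (\<Sum>y\<in>orb. f x)"
      by (rule sum.cong) (use inN[OF x(1)] x(2) in \<open>auto simp: f_def\<close>)
    then have sum: "(\<Sum>y\<in>orb. f y) = card orb * f x" by simp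
    show ?thesis
    proof (cases "x \<in> N")
      case False
      then have "f x = 0" by (simp add: f_def)
      then show ?thesis using sum by simp
    next
      case True
      have xo: "x \<in> orb" using c.orbit_refl[OF x(1)] x(2) by simp
      have "card orb \<noteq> 1"
      proof
        assume "card orb = 1"
        then have orbx: "orb = {x}" using xo by (metis card_1_singletonE singletonD)
        have "x \<otimes> g = g \<otimes> x" if "g \<in> carrier G" for g
        proof -
          have "g \<otimes> x \<otimes> inv g = x" using orbx x(2) orb[OF x(1)] that by auto
          then show ?thesis using that x(1) by (metis inv_solve_right' m_closed)
        qed
        then have "x \<in> center G" using x(1) by (simp add: center_def)
        then have "x = \<one>" using triv True by simp
        then show False using x orbx by simp
      qed
      moreover have "card orb dvd card (carrier G)"
        using c.orbit_stabilizer_theorem[OF x(1), folded x(2)] unfolding order_def by (rule dvdI[OF sym])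
      then obtain j where "card orb = p ^ j"
        using card_power divides_primepow_nat[OF prime_p] by auto
      ultimately have "p dvd card orb" by (cases j) auto
      then show ?thesis by (simp add: sum)
    qed
  qed
  have "card N = 1 + (\<Sum>orb\<in>orbits G (carrier G) ?c - {{\<one>}}. \<Sum>x\<in>orb. f x)"
    using cardN sum.remove[OF fino mem1, of "\<lambda>orb. \<Sum>x\<in>orb. f x"] subgroup.one_closed[OF NG]
    by (simp add: f_def)
  moreover have "p dvd (\<Sum>orb\<in>orbits G (carrier G) ?c - {{\<one>}}. \<Sum>x\<in>orb. f x)"
    using dvd by (rule dvd_sum)
  moreover have "p dvd card N"
  proof -
    obtain j where j: "card N = p ^ j" by (rule card_subgroup_power[OF NG])
    have "card N \<noteq> 1"
      using nontriv subgroup.one_closed[OF NG] by (metis card_1_singletonE singletonD)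
    then show ?thesis using j by (cases j) auto
  qed
  ultimately have "p dvd 1" by (simp only: dvd_add_left_iff)
  then show False using prime_p by (simp add: prime_nat_iff)
qed

end

section \<open>Homomorphisms to the integers modulo p, with maximal subgroups as their
  kernels\<close>

definition mod_character :: "('a, 'b) monoid_scheme \<Rightarrow> nat \<Rightarrow> ('a \<Rightarrow> int) \<Rightarrow> bool" where
  "mod_character G p \<chi> \<longleftrightarrow>
    (\<forall>x \<in> carrier G. \<forall>y \<in> carrier G. int p dvd \<chi> (x \<otimes>\<^bsub>G\<^esub> y) - (\<chi> x + \<chi> y))"

text \<open>A homomorphism to Z/p is represented by integers that add up modulo \<open>p\<close>, so
  that two of them can be added pointwise. In a finite \<open>p\<close>-group the proper kernels are
  the maximal subgroups.\<close>

definition mod_kernel :: "('a, 'b) monoid_scheme \<Rightarrow> nat \<Rightarrow> ('a \<Rightarrow> int) \<Rightarrow> 'a set" where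
  "mod_kernel G p \<chi> = {x \<in> carrier G. int p dvd \<chi> x}"

lemma mod_character_add:
  assumes "mod_character G p \<chi>" "mod_character G p \<psi>"
  shows "mod_character G p (\<lambda>x. \<chi> x + \<psi> x)"
  unfolding mod_character_def
proof (intro ballI)
  fix x y assume "x \<in> carrier G" "y \<in> carrier G"
  then have "int p dvd (\<chi> (x \<otimes>\<^bsub>G\<^esub> y) - (\<chi> x + \<chi> y)) + (\<psi> (x \<otimes>\<^bsub>G\<^esub> y) - (\<psi> x + \<psi> y))"
    using assms by (intro dvd_add) (auto simp: mod_character_def)
  then show "int p dvd \<chi> (x \<otimes>\<^bsub>G\<^esub> y) + \<psi> (x \<otimes>\<^bsub>G\<^esub> y) - (\<chi> x + \<psi> x + (\<chi> y + \<psi> y))"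
    by (simp add: algebra_simps)
qed

context group
begin

lemma mod_character_mult_iff:
  assumes "mod_character G p \<chi>" "x \<in> carrier G" "y \<in> carrier G"
  shows "int p dvd \<chi> (x \<otimes> y) \<longleftrightarrow> int p dvd \<chi> x + \<chi> y"
proof -
  have "int p dvd \<chi> (x \<otimes> y) - (\<chi> x + \<chi> y)" using assms by (simp add: mod_character_def)
  then show ?thesis by (metis diff_add_cancel dvd_add_right_iff)
qed

lemma mod_character_one:
  assumes "mod_character G p \<chi>"
  shows "int p dvd \<chi> \<one>"
proof -
  have "int p dvd \<chi> \<one> - (\<chi> \<one> + \<chi> \<one>)" using assms unfolding mod_character_def by (metis one_closed r_one)
  then show ?thesis by simp
qed

lemma mod_kernel_normal:
  assumes \<chi>: "mod_character G p \<chi>"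
  shows "mod_kernel G p \<chi> \<lhd> G"
proof (rule normal_invI)
  have inv: "int p dvd \<chi> x + \<chi> (inv x)" if "x \<in> carrier G" for x
    using mod_character_mult_iff[OF \<chi> that inv_closed[OF that]] mod_character_one[OF \<chi>] that by simp
  show "subgroup (mod_kernel G p \<chi>) G"
  proof (rule subgroupI)
    show "mod_kernel G p \<chi> \<noteq> {}" using mod_character_one[OF \<chi>] by (auto simp: mod_kernel_def)
    fix a b assume a: "a \<in> mod_kernel G p \<chi>"
    then show "inv a \<in> mod_kernel G p \<chi>"
      using inv[of a] by (auto simp: mod_kernel_def dvd_add_right_iff)
    assume "b \<in> mod_kernel G p \<chi>"
    with a show "a \<otimes> b \<in> mod_kernel G p \<chi>"
      using mod_character_mult_iff[OF \<chi>, of a b] by (auto simp: mod_kernel_def)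
  qed (auto simp: mod_kernel_def)
  fix x h assume x: "x \<in> carrier G" and h: "h \<in> mod_kernel G p \<chi>"
  have "int p dvd \<chi> (x \<otimes> h) - (\<chi> x + \<chi> h)"
    using \<chi> x h by (auto simp: mod_kernel_def mod_character_def)
  moreover have "int p dvd \<chi> h" using h by (simp add: mod_kernel_def)
  ultimately have "int p dvd (\<chi> (x \<otimes> h) - (\<chi> x + \<chi> h)) + (\<chi> x + \<chi> (inv x)) + \<chi> h"
    by (rule dvd_add[OF dvd_add[OF _ inv[OF x]]])
  then have "int p dvd \<chi> (x \<otimes> h) + \<chi> (inv x)" by simp
  then show "x \<otimes> h \<otimes> inv x \<in> mod_kernel G p \<chi>"
    using mod_character_mult_iff[OF \<chi>, of "x \<otimes> h" "inv x"] x h by (auto simp: mod_kernel_def)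
qed

lemma mod_character_nat_pow:
  assumes \<chi>: "mod_character G p \<chi>" and y: "y \<in> carrier G"
  shows "int p dvd \<chi> (y [^] (j::nat)) - int j * \<chi> y"
proof (induction j)
  case 0
  then show ?case using mod_character_one[OF \<chi>] by simp
next
  case (Suc j)
  have "int p dvd \<chi> (y [^] j \<otimes> y) - (\<chi> (y [^] j) + \<chi> y)"
    using \<chi> y by (simp add: mod_character_def)
  from dvd_add[OF this Suc.IH] show ?case by (simp add: algebra_simps)
qed

text \<open>As \<open>\<chi> y\<close> is invertible modulo \<open>p\<close>, some exponent
  \<open>j\<close> makes \<open>\<chi> g + j * \<chi> y\<close> vanish modulo \<open>p\<close>. Thus
  \<open>G\<close> is the product of the kernel and the powers of any element outside it.\<close>

lemma mod_kernel_mult_pow: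
  assumes p: "Factorial_Ring.prime p" and \<chi>: "mod_character G p \<chi>"
    and y: "y \<in> carrier G" "y \<notin> mod_kernel G p \<chi>" and g: "g \<in> carrier G"
  obtains j :: nat where "g \<otimes> y [^] j \<in> mod_kernel G p \<chi>"
proof -
  have "coprime (\<chi> y) (int p)"
    using y p prime_imp_coprime[of "int p" "\<chi> y"] by (simp add: mod_kernel_def coprime_commute)
  then obtain a b where ab: "a * \<chi> y + b * int p = 1"
    using bezout_int[of "\<chi> y" "int p"] by auto
  define j where "j = nat ((- \<chi> g * a) mod int p)"
  have "int j = (- \<chi> g * a) mod int p"
    using p prime_gt_0_nat by (simp add: j_def)
  then have "int j mod int p = (- \<chi> g * a) mod int p" by simp
  then have "int p dvd int j - (- \<chi> g * a)" by (simp only: mod_eq_dvd_iff)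
  then have "int p dvd (int j + \<chi> g * a) * \<chi> y" by simp
  moreover have "\<chi> g = \<chi> g * (a * \<chi> y + b * int p)" using ab by simp
  then have "\<chi> g + int j * \<chi> y = (int j + \<chi> g * a) * \<chi> y + int p * (\<chi> g * b)"
    by (simp add: algebra_simps)
  ultimately have "int p dvd \<chi> g + int j * \<chi> y" by simp
  then have "int p dvd (\<chi> g + int j * \<chi> y) + (\<chi> (y [^] j) - int j * \<chi> y)"
    using mod_character_nat_pow[OF \<chi> y(1), of j] by (rule dvd_add)
  then have "int p dvd \<chi> g + \<chi> (y [^] j)" by simp
  then have "g \<otimes> y [^] j \<in> mod_kernel G p \<chi>"
    using mod_character_mult_iff[OF \<chi> g nat_pow_closed[OF y(1)], of j] g y by (simp add: mod_kernel_def)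
  then show ?thesis by (rule that)
qed

end

context group
begin

lemma vimage_hom_mod_character:
  assumes "group_hom G Q h" "mod_character Q p \<chi>"
  shows "mod_character G p (\<lambda>x. \<chi> (h x))"
proof -
  interpret h: group_hom G Q h by fact
  show ?thesis using assms(2) by (simp add: mod_character_def)
qed

text \<open>Send x^k to k. The exponent is determined only modulo the order of \<open>x\<close>, but
  this is the group order and so a multiple of \<open>p\<close>; hence any choice of exponents is
  additive modulo \<open>p\<close>.\<close>

lemma cyclic_mod_character:
  assumes fin: "finite (carrier G)" and x: "x \<in> carrier G" "generate G {x} = carrier G"
    and p: "p dvd card (carrier G)" "p \<noteq> 1"
  obtains \<chi> where "mod_character G p \<chi>" "mod_kernel G p \<chi> \<noteq> carrier G"
proof -
  have ord: "ord x = card (carrier G)"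
    using generate_pow_card[OF x(1)] x(2) by simp
  define \<chi> where "\<chi> g = (SOME k :: int. g = x [^] k)" for g
  have \<chi>: "g = x [^] \<chi> g" if "g \<in> carrier G" for g
  proof -
    have "\<exists>k :: int. g = x [^] k" using that x generate_pow[OF x(1)] by auto
    then show ?thesis unfolding \<chi>_def by (rule someI_ex)
  qed
  have dvd: "int p dvd k - l" if "x [^] (k::int) = x [^] l" for k l
  proof -
    have "x [^] (k - l) = \<one>" using that x(1) by (simp add: int_pow_diff)
    then have "int (ord x) dvd k - l" using int_pow_eq_id[OF x(1)] by simp
    then show ?thesis using p(1) ord by (metis dvd_trans int_dvd_int_iff)
  qed
  have "mod_character G p \<chi>"
    unfolding mod_character_def
  proof (intro ballI)
    fix a b assume ab: "a \<in> carrier G" "b \<in> carrier G"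
    have "x [^] \<chi> (a \<otimes> b) = x [^] (\<chi> a + \<chi> b)"
      using \<chi>[of "a \<otimes> b"] \<chi>[OF ab(1)] \<chi>[OF ab(2)] ab x(1) by (simp add: int_pow_mult)
    then show "int p dvd \<chi> (a \<otimes> b) - (\<chi> a + \<chi> b)" by (rule dvd)
  qed
  moreover have "x \<notin> mod_kernel G p \<chi>"
  proof
    assume "x \<in> mod_kernel G p \<chi>"
    then have "int p dvd \<chi> x" by (simp add: mod_kernel_def)
    moreover have "int p dvd 1 - \<chi> x"
      using \<chi>[OF x(1)] x(1) by (intro dvd) (simp add: int_pow_1)
    ultimately have "int p dvd 1" by (metis diff_add_cancel dvd_add)
    then show False using p(2) by simp
  qed
  ultimately show ?thesis using that x(1) by blast
qed

lemma center_normal: "center G \<lhd> G"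
proof (rule normal_invI)
  show "subgroup (center G) G"
  proof (rule subgroupI)
    fix a assume a: "a \<in> center G"
    then show "inv a \<in> center G"
      unfolding center_def
    proof (intro CollectI conjI ballI)
      fix g assume g: "g \<in> carrier G"
      have aG: "a \<in> carrier G" and "a \<otimes> inv g = inv g \<otimes> a"
        using center_closed[OF a] center_commute[OF a] g by auto
      then have "inv (a \<otimes> inv g) = inv (inv g \<otimes> a)" by metis
      then show "inv a \<otimes> g = g \<otimes> inv a" using aG g by (simp add: inv_mult_group)
    qed (use center_closed[OF a] in simp)
    fix b assume b: "b \<in> center G"
    show "a \<otimes> b \<in> center G"
      unfolding center_def
    proof (intro CollectI conjI ballI)
      fix g assume g: "g \<in> carrier G"
      have ab: "a \<in> carrier G" "b \<in> carrier G" and comm: "a \<otimes> g = g \<otimes> a" "b \<otimes> g = g \<otimes> b"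
        using center_closed[OF a] center_closed[OF b] center_commute[OF a g] center_commute[OF b g] by auto
      have "a \<otimes> b \<otimes> g = a \<otimes> (g \<otimes> b)" using ab g by (simp add: m_assoc comm(2))
      also have "\<dots> = a \<otimes> g \<otimes> b" using ab g by (simp add: m_assoc)
      also have "\<dots> = g \<otimes> (a \<otimes> b)" using ab g by (simp add: m_assoc comm(1))
      finally show "a \<otimes> b \<otimes> g = g \<otimes> (a \<otimes> b)" .
    qed (use center_closed[OF a] center_closed[OF b] in simp)
  qed (auto simp: center_def intro: exI[of _ \<one>])
  fix x h assume "x \<in> carrier G" "h \<in> center G"
  then have "x \<otimes> h \<otimes> inv x = h"
    using center_closed[of h G] center_commute[of h G x, symmetric] by (simp add: m_assoc)
  then show "x \<otimes> h \<otimes> inv x \<in> center G" using \<open>h \<in> center G\<close> by simp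
qed

end

text \<open>Induction step on the group order. If HN is proper for some nontrivial normal
  \<open>N\<close>, a character of G/N is pulled back. Otherwise taking the center for
  \<open>N\<close> shows that \<open>H\<close> is normal, hence trivial, so \<open>G\<close> is
  abelian and equal to each of its nontrivial cyclic subgroups. The step is separate from the
  induction because quotients have type \<open>'a monoid\<close>, while \<open>G\<close> may be a
  larger record.\<close>

lemma (in finite_p_group) mod_character_vanishing_on_proper_subgroup_aux:
  assumes H: "subgroup H G" "H \<noteq> carrier G"
    and IH: "\<And>(Q :: 'a monoid) H'. \<lbrakk>finite_p_group Q p; card (carrier Q) < card (carrier G);
      subgroup H' Q; H' \<noteq> carrier Q\<rbrakk> \<Longrightarrow>
      \<exists>\<chi>. mod_character Q p \<chi> \<and> H' \<subseteq> mod_kernel Q p \<chi> \<and> mod_kernel Q p \<chi> \<noteq> carrier Q"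
  shows "\<exists>\<chi>. mod_character G p \<chi> \<and> H \<subseteq> mod_kernel G p \<chi> \<and> mod_kernel G p \<chi> \<noteq> carrier G"
proof (cases "\<exists>N. N \<lhd> G \<and> N \<noteq> {\<one>} \<and> H <#> N \<noteq> carrier G")
  case True
  then obtain N where N: "N \<lhd> G" "N \<noteq> {\<one>}" "H <#> N \<noteq> carrier G" by blast
  obtain Q :: "'a monoid" and h where h: "group_hom G Q h" "h ` carrier G = carrier Q" "kernel G Q h = N"
    by (rule quotient_on_representatives[OF N(1)])
  interpret h: group_hom G Q h by (rule h(1))
  have NG: "subgroup N G" using N(1) by (rule normal_imp_subgroup)
  have "card (carrier G) = card N * card (carrier Q)"
  proof -
    have "{g \<in> carrier G. h g \<in> carrier Q} = carrier G" by auto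
    then show ?thesis using h.card_vimage[OF fin h(2) subset_refl] h(3) by simp
  qed
  moreover have "card N \<noteq> 1"
    using N(2) subgroup.one_closed[OF NG] by (metis card_1_singletonE singletonD)
  ultimately have less: "card (carrier Q) < card (carrier G)"
    using card_subgroup_pos[OF subgroup_self] by (cases "card N") auto
  have img: "subgroup (h ` H) Q" using h.subgroup_img_is_subgroup[OF H(1)] .
  have "h ` H \<noteq> carrier Q"
  proof
    assume eq: "h ` H = carrier Q"
    have "g \<in> H <#> N" if g: "g \<in> carrier G" for g
    proof -
      obtain k where k: "k \<in> H" "h g = h k" using eq g h.hom_closed by (metis imageE)
      have kG: "k \<in> carrier G" using subgroup.mem_carrier[OF H(1) k(1)] .
      have "inv k \<otimes> g \<in> N" using k kG g h(3) by (auto simp: kernel_def)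
      moreover have "g = k \<otimes> (inv k \<otimes> g)" using kG g by (simp add: m_assoc[symmetric])
      ultimately show ?thesis using k(1) unfolding set_mult_def by blast
    qed
    moreover have "H <#> N \<subseteq> carrier G"
      using set_mult_closed subgroup.subset[OF H(1)] subgroup.subset[OF NG] by blast
    ultimately show False using N(3) by blast
  qed
  then obtain \<chi> where \<chi>: "mod_character Q p \<chi>" "h ` H \<subseteq> mod_kernel Q p \<chi>"
    "mod_kernel Q p \<chi> \<noteq> carrier Q"
    using IH[OF surjective_image_is_p_group[OF h(1,2)] less img] by blast
  obtain q where "q \<in> carrier Q" "q \<notin> mod_kernel Q p \<chi>"
    using \<chi>(3) by (auto simp: mod_kernel_def)
  moreover from this obtain g where "g \<in> carrier G" "q = h g" using h(2) by (metis imageE)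
  ultimately have "g \<in> carrier G" "\<not> int p dvd \<chi> (h g)" by (auto simp: mod_kernel_def)
  then have "mod_kernel G p (\<lambda>x. \<chi> (h x)) \<noteq> carrier G" by (auto simp: mod_kernel_def)
  moreover have "H \<subseteq> mod_kernel G p (\<lambda>x. \<chi> (h x))"
    using \<chi>(2) subgroup.mem_carrier[OF H(1)] by (auto simp: mod_kernel_def)
  ultimately show ?thesis using vimage_hom_mod_character[OF h(1) \<chi>(1)] by blast
next
  case False
  then have full: "\<And>N. N \<lhd> G \<Longrightarrow> N \<noteq> {\<one>} \<Longrightarrow> H <#> N = carrier G" by blast
  have sub: "H \<subseteq> carrier G" using subgroup.subset[OF H(1)] .
  have nontriv: "carrier G \<noteq> {\<one>}" using H subgroup.one_closed[OF H(1)] sub by auto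
  obtain z where "z \<in> carrier G" "z \<noteq> \<one>" "z \<in> center G"
    by (rule normal_subgroup_meets_center[OF normal_self nontriv])
  then have HZ: "H <#> center G = carrier G" using full[OF center_normal] by blast
  \<comment> \<open>\<open>H\<close> is normalized by itself and by the center, and \<open>G\<close>
    is the product of the two.\<close>
  have "H \<lhd> G"
  proof (rule normal_invI[OF H(1)])
    fix x k assume x: "x \<in> carrier G" and k: "k \<in> H"
    obtain y c where yc: "y \<in> H" "c \<in> center G" "x = y \<otimes> c"
      using x HZ[symmetric] by (auto simp: set_mult_def)
    have G: "y \<in> carrier G" "c \<in> carrier G" "k \<in> carrier G"
      using yc(1) k sub center_closed[OF yc(2)] by auto
    have "x \<otimes> k \<otimes> inv x = y \<otimes> (c \<otimes> k) \<otimes> inv c \<otimes> inv y"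
      using yc G by (simp add: m_assoc inv_mult_group)
    also have "c \<otimes> k = k \<otimes> c" using center_commute[OF yc(2)] G by simp
    also have "y \<otimes> (k \<otimes> c) \<otimes> inv c \<otimes> inv y = y \<otimes> k \<otimes> inv y"
      using G by (simp add: m_assoc)
    finally show "x \<otimes> k \<otimes> inv x \<in> H"
      using yc(1) k H(1) by (simp add: subgroup.m_closed subgroup.m_inv_closed)
  qed
  moreover have "H <#> H = H" using subgroup_mult_id[OF H(1)] .
  \<comment> \<open>If \<open>H\<close> were nontrivial it could serve as \<open>N\<close>, which
    would give H = HH = G.\<close>
  ultimately have H1: "H = {\<one>}" using full H(2) by metis
  have cen: "center G = carrier G"
  proof -
    have "{\<one>} <#> center G = center G"
      by (auto simp: set_mult_def center_def)
    then show ?thesis using HZ H1 by simp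
  qed
  obtain x where x: "x \<in> carrier G" "x \<noteq> \<one>" using nontriv by auto
  have sg: "subgroup (generate G {x}) G" using generate_is_subgroup x(1) by simp
  have "generate G {x} \<lhd> G"
  proof (rule normal_invI[OF sg])
    fix y k assume "y \<in> carrier G" "k \<in> generate G {x}"
    moreover have kG: "k \<in> carrier G" using subgroup.mem_carrier[OF sg] calculation by blast
    ultimately have "y \<otimes> k = k \<otimes> y" using center_commute[of y G k] cen by simp
    then have "y \<otimes> k \<otimes> inv y = k" using kG \<open>y \<in> carrier G\<close> by (simp add: m_assoc)
    then show "y \<otimes> k \<otimes> inv y \<in> generate G {x}" using \<open>k \<in> generate G {x}\<close> by simp
  qed
  moreover have "x \<in> generate G {x}" by (simp add: generate.incl)
  ultimately have "{\<one>} <#> generate G {x} = carrier G" using full H1 x(2) by (metis singletonD)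
  moreover have "{\<one>} <#> generate G {x} = generate G {x}"
    using subgroup.mem_carrier[OF sg] by (auto simp: set_mult_def)
  ultimately have gen: "generate G {x} = carrier G" by simp
  have "p dvd card (carrier G)"
  proof -
    obtain k where k: "card (carrier G) = p ^ k" using card_power by blast
    have "card (carrier G) \<noteq> 1" using x one_closed by (metis card_1_singletonE singletonD)
    then show ?thesis using k by (cases k) auto
  qed
  then obtain \<chi> where "mod_character G p \<chi>" "mod_kernel G p \<chi> \<noteq> carrier G"
    using cyclic_mod_character[OF fin x(1) gen] prime_p by (metis not_prime_1)
  moreover have "H \<subseteq> mod_kernel G p \<chi>"
    using H1 mod_character_one[OF calculation(1)] by (simp add: mod_kernel_def)
  ultimately show ?thesis by blast
qed

lemma mod_character_vanishing_on_proper_subgroup_monoid: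
  fixes G :: "'a monoid"
  assumes "finite_p_group G p" "subgroup H G" "H \<noteq> carrier G"
  shows "\<exists>\<chi>. mod_character G p \<chi> \<and> H \<subseteq> mod_kernel G p \<chi> \<and> mod_kernel G p \<chi> \<noteq> carrier G"
  using assms
proof (induction "card (carrier G)" arbitrary: G H rule: less_induct)
  case less
  show ?case
    by (rule finite_p_group.mod_character_vanishing_on_proper_subgroup_aux[OF less.prems])
      (rule less.hyps)
qed

lemma (in finite_p_group) mod_character_vanishing_on_proper_subgroup:
  assumes "subgroup H G" "H \<noteq> carrier G"
  obtains \<chi> where "mod_character G p \<chi>" "H \<subseteq> mod_kernel G p \<chi>" "mod_kernel G p \<chi> \<noteq> carrier G"
  using mod_character_vanishing_on_proper_subgroup_aux[OF assms]
    mod_character_vanishing_on_proper_subgroup_monoid by blast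

section \<open>Commutators\<close>

context group
begin

lemma centralizer_subgroup:
  assumes x: "x \<in> carrier G"
  shows "subgroup (centralizer G x) G"
proof (rule subgroupI)
  show "centralizer G x \<noteq> {}" using x by (auto simp: centralizer_def intro: exI[of _ \<one>])
  fix a assume "a \<in> centralizer G x"
  then have a: "a \<in> carrier G" "a \<otimes> x = x \<otimes> a" by (auto simp: centralizer_def)
  have "inv a \<otimes> x = inv a \<otimes> (x \<otimes> a) \<otimes> inv a" using a(1) x by (simp add: m_assoc)
  also have "\<dots> = inv a \<otimes> (a \<otimes> x) \<otimes> inv a" by (simp only: a(2))
  also have "\<dots> = x \<otimes> inv a" using a(1) x by (simp add: m_assoc[symmetric])
  finally show "inv a \<in> centralizer G x" using a(1) by (simp add: centralizer_def)
  fix b assume "b \<in> centralizer G x"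
  then have b: "b \<in> carrier G" "b \<otimes> x = x \<otimes> b" by (auto simp: centralizer_def)
  have "a \<otimes> b \<otimes> x = a \<otimes> x \<otimes> b" using a(1) b(1) x by (simp add: b(2) m_assoc)
  also have "\<dots> = x \<otimes> (a \<otimes> b)" using a(1) b(1) x by (simp add: a(2) m_assoc)
  finally show "a \<otimes> b \<in> centralizer G x" using a b by (simp add: centralizer_def)
qed (auto simp: centralizer_def)

lemma centralizer_sym: "\<lbrakk>x \<in> carrier G; y \<in> carrier G\<rbrakk> \<Longrightarrow> y \<in> centralizer G x \<longleftrightarrow> x \<in> centralizer G y"
  by (auto simp: centralizer_def)

lemma in_center_iff: "x \<in> carrier G \<Longrightarrow> x \<in> center G \<longleftrightarrow> centralizer G x = carrier G"
proof -
  assume x: "x \<in> carrier G"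
  have "centralizer G x = carrier G \<longleftrightarrow> (\<forall>g\<in>carrier G. g \<otimes> x = x \<otimes> g)"
    by (auto simp: centralizer_def)
  also have "\<dots> \<longleftrightarrow> (\<forall>g\<in>carrier G. x \<otimes> g = g \<otimes> x)" by metis
  finally show ?thesis using x by (simp add: center_def)
qed

lemma commutator_closed: "\<lbrakk>x \<in> carrier G; y \<in> carrier G\<rbrakk> \<Longrightarrow> commutator G x y \<in> carrier G"
  by (simp add: commutator_def)

lemma commutator_mult: "\<lbrakk>x \<in> carrier G; y \<in> carrier G\<rbrakk> \<Longrightarrow> commutator G x y \<otimes> (y \<otimes> x) = x \<otimes> y"
  by (simp add: commutator_def m_assoc) (simp add: m_assoc[symmetric])

lemma inv_commutator: "\<lbrakk>x \<in> carrier G; y \<in> carrier G\<rbrakk> \<Longrightarrow> inv (commutator G x y) = commutator G y x"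
  by (simp add: commutator_def inv_mult_group m_assoc)

lemma commutator_eq_one_iff:
  assumes "x \<in> carrier G" "y \<in> carrier G"
  shows "commutator G x y = \<one> \<longleftrightarrow> y \<in> centralizer G x"
proof -
  have "commutator G x y = \<one> \<longleftrightarrow> commutator G x y \<otimes> (y \<otimes> x) = \<one> \<otimes> (y \<otimes> x)"
    using assms commutator_closed by simp
  then show ?thesis using assms commutator_mult by (auto simp: centralizer_def)
qed

lemma commutator_in_derived:
  assumes "x \<in> H" "y \<in> H"
  shows "commutator G x y \<in> derived G H"
  unfolding derived_def commutator_def using assms by (intro generate.incl) blast

lemma derived_subset_if_commutators:
  assumes "subgroup N G" "\<And>x y. x \<in> H \<Longrightarrow> y \<in> H \<Longrightarrow> commutator G x y \<in> N"
  shows "derived G H \<subseteq> N"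
  unfolding derived_def
  using assms by (intro generate_subgroup_incl) (auto simp: commutator_def)

lemma commutator_mult_centralizing:
  assumes "x \<in> carrier G" "y \<in> carrier G" "c \<in> centralizer G x"
  shows "commutator G x (y \<otimes> c) = commutator G x y"
proof -
  have c: "c \<in> carrier G" "c \<otimes> x = x \<otimes> c" using assms(3) by (auto simp: centralizer_def)
  have "y \<otimes> x \<otimes> c = y \<otimes> c \<otimes> x" using assms(1,2) c(1) by (simp add: m_assoc c(2))
  then have "commutator G x (y \<otimes> c) \<otimes> (y \<otimes> x \<otimes> c) = x \<otimes> y \<otimes> c"
    using commutator_mult[of x "y \<otimes> c"] assms(1,2) c(1) by (simp add: m_assoc)
  also have "\<dots> = commutator G x y \<otimes> (y \<otimes> x) \<otimes> c"
    using commutator_mult[of x y] assms(1,2) by simp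
  also have "\<dots> = commutator G x y \<otimes> (y \<otimes> x \<otimes> c)"
    using assms(1,2) c(1) commutator_closed by (simp add: m_assoc)
  finally show ?thesis
    by (rule r_cancel) (use assms(1,2) c(1) commutator_closed in simp_all)
qed

lemma derived_subset_mod_kernel:
  assumes \<chi>: "mod_character G p \<chi>"
  shows "derived G (carrier G) \<subseteq> mod_kernel G p \<chi>"
proof (rule derived_subset_if_commutators)
  show "subgroup (mod_kernel G p \<chi>) G" using mod_kernel_normal[OF \<chi>] by (rule normal_imp_subgroup)
  fix x y assume xy: "x \<in> carrier G" "y \<in> carrier G"
  let ?c = "commutator G x y"
  have "int p dvd \<chi> (?c \<otimes> (y \<otimes> x)) - (\<chi> ?c + \<chi> (y \<otimes> x))"
    using \<chi> xy commutator_closed by (simp add: mod_character_def)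
  then have 1: "int p dvd \<chi> (x \<otimes> y) - (\<chi> ?c + \<chi> (y \<otimes> x))" using commutator_mult xy by simp
  have 2: "int p dvd \<chi> (x \<otimes> y) - (\<chi> x + \<chi> y)" "int p dvd \<chi> (y \<otimes> x) - (\<chi> y + \<chi> x)"
    using \<chi> xy by (auto simp: mod_character_def)
  have "\<chi> ?c = (\<chi> (x \<otimes> y) - (\<chi> x + \<chi> y)) - (\<chi> (y \<otimes> x) - (\<chi> y + \<chi> x))
      - (\<chi> (x \<otimes> y) - (\<chi> ?c + \<chi> (y \<otimes> x)))" by simp
  then have "int p dvd \<chi> ?c" using dvd_diff[OF dvd_diff[OF 2] 1] by simp
  then show "?c \<in> mod_kernel G p \<chi>" using xy commutator_closed by (simp add: mod_kernel_def)
qed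

text \<open>Extends a property from \<open>K\<close> and \<open>y\<close> to all of \<open>G\<close>
  whenever the elements having it form a subgroup \<open>W\<close>.\<close>

lemma generated_by_coset_powers:
  assumes dec: "\<And>g. g \<in> carrier G \<Longrightarrow> \<exists>k \<in> K. \<exists>j::nat. g = k \<otimes> y [^] j"
    and W: "subgroup W G" "K \<subseteq> W" "y \<in> W"
  shows "W = carrier G"
proof -
  have "y [^] (j::nat) \<in> W" for j
    by (induction j) (use W in \<open>auto intro: subgroup.one_closed subgroup.m_closed\<close>)
  then have "carrier G \<subseteq> W" using dec W by (blast intro: subgroup.m_closed[OF W(1)])
  then show ?thesis using subgroup.subset[OF W(1)] by blast
qed

section \<open>Commutation with an element of the second center\<close>

lemma central_commutator_mult:
  assumes u: "u \<in> carrier G" "\<And>g. g \<in> carrier G \<Longrightarrow> commutator G u g \<in> center G"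
    and gh: "g \<in> carrier G" "h \<in> carrier G"
  shows "commutator G u (g \<otimes> h) = commutator G u g \<otimes> commutator G u h"
proof -
  let ?a = "commutator G u g" and ?b = "commutator G u h"
  have ab: "?a \<in> carrier G" "?b \<in> carrier G" using u gh commutator_closed by auto
  have "?a \<otimes> ?b \<otimes> (g \<otimes> h \<otimes> u) = ?a \<otimes> (?b \<otimes> g) \<otimes> (h \<otimes> u)"
    using ab gh u(1) by (simp add: m_assoc)
  also have "\<dots> = ?a \<otimes> (g \<otimes> ?b) \<otimes> (h \<otimes> u)"
    by (simp only: center_commute[OF u(2)[OF gh(2)] gh(1)])
  also have "\<dots> = ?a \<otimes> g \<otimes> (?b \<otimes> (h \<otimes> u))" using ab gh u(1) by (simp add: m_assoc)
  also have "\<dots> = ?a \<otimes> g \<otimes> (u \<otimes> h)" by (simp only: commutator_mult[OF u(1) gh(2)])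
  also have "\<dots> = ?a \<otimes> (g \<otimes> u) \<otimes> h" using ab gh u(1) by (simp add: m_assoc)
  also have "\<dots> = u \<otimes> g \<otimes> h" by (simp only: commutator_mult[OF u(1) gh(1)])
  also have "\<dots> = u \<otimes> (g \<otimes> h)" using gh u(1) by (simp add: m_assoc)
  also have "\<dots> = commutator G u (g \<otimes> h) \<otimes> (g \<otimes> h \<otimes> u)"
    using commutator_mult[of u "g \<otimes> h"] gh u(1) by simp
  finally have "?a \<otimes> ?b \<otimes> (g \<otimes> h \<otimes> u) = commutator G u (g \<otimes> h) \<otimes> (g \<otimes> h \<otimes> u)" .
  then have "?a \<otimes> ?b = commutator G u (g \<otimes> h)"
    by (rule r_cancel) (use ab gh u(1) commutator_closed in simp_all)
  then show ?thesis by simp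
qed

text \<open>The second hypothesis says that \<open>u\<close> lies in the second center. Then g to
  [u, g] is a homomorphism into the center with kernel C(u), so its fibres are the left cosets of
  C(u).\<close>

lemma central_commutator_eq_iff:
  assumes u: "u \<in> carrier G" "\<And>g. g \<in> carrier G \<Longrightarrow> commutator G u g \<in> center G"
    and gh: "g \<in> carrier G" "h \<in> carrier G"
  shows "commutator G u g = commutator G u h \<longleftrightarrow> inv g \<otimes> h \<in> centralizer G u"
proof -
  let ?d = "commutator G u (inv g \<otimes> h)"
  have d: "?d \<in> carrier G" using u gh commutator_closed by simp
  have "commutator G u h = commutator G u (g \<otimes> (inv g \<otimes> h))"
    using gh by (simp add: m_assoc[symmetric])
  also have "\<dots> = commutator G u g \<otimes> ?d" using central_commutator_mult[OF u] gh by simp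
  finally have "commutator G u g = commutator G u h \<longleftrightarrow> ?d = \<one>"
    using d gh u commutator_closed by (metis l_cancel_one r_one)
  then show ?thesis using commutator_eq_one_iff u gh by simp
qed

lemma central_commutators_normal:
  assumes u: "u \<in> carrier G" "\<And>g. g \<in> carrier G \<Longrightarrow> commutator G u g \<in> center G"
    and S: "subgroup S G"
  shows "commutator G u ` S \<lhd> G"
proof (rule normal_invI)
  have sub: "S \<subseteq> carrier G" using subgroup.subset[OF S] .
  have one: "commutator G u \<one> = \<one>" using u by (simp add: commutator_def)
  show "subgroup (commutator G u ` S) G"
  proof (rule subgroupI)
    show "commutator G u ` S \<subseteq> carrier G" using sub u commutator_closed by blast
    show "commutator G u ` S \<noteq> {}" using subgroup.one_closed[OF S] by blast
    fix a assume "a \<in> commutator G u ` S"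
    then obtain s where s: "s \<in> S" "a = commutator G u s" by blast
    have sG: "s \<in> carrier G" using sub s by blast
    have "a \<otimes> commutator G u (inv s) = \<one>"
      using central_commutator_mult[OF u, of s "inv s"] s sG one by simp
    then have "inv a = commutator G u (inv s)"
      using s sG u commutator_closed by (metis inv_closed inv_equality inv_inv)
    then show "inv a \<in> commutator G u ` S" using subgroup.m_inv_closed[OF S s(1)] by blast
    fix b assume "b \<in> commutator G u ` S"
    then obtain t where t: "t \<in> S" "b = commutator G u t" by blast
    have "a \<otimes> b = commutator G u (s \<otimes> t)"
      using central_commutator_mult[OF u, of s t] s t subsetD[OF sub] by simp
    then show "a \<otimes> b \<in> commutator G u ` S" using subgroup.m_closed[OF S s(1) t(1)] by blast
  qed
  fix x h assume x: "x \<in> carrier G" and h: "h \<in> commutator G u ` S"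
  have "h \<in> center G" using h u(2) sub by blast
  then have "x \<otimes> h \<otimes> inv x = h"
    using center_closed[of h G] center_commute[of h G x, symmetric] x by (simp add: m_assoc)
  then show "x \<otimes> h \<otimes> inv x \<in> commutator G u ` S" using h by simp
qed

text \<open>The homomorphism g to [u, g] has an abelian target, so its kernel C(u) contains all
  commutators.\<close>

lemma derived_subset_centralizer:
  assumes u: "u \<in> carrier G" "\<And>g. g \<in> carrier G \<Longrightarrow> commutator G u g \<in> center G"
  shows "derived G (carrier G) \<subseteq> centralizer G u"
proof (rule derived_subset_if_commutators[OF centralizer_subgroup[OF u(1)]])
  fix x y assume xy: "x \<in> carrier G" "y \<in> carrier G"
  \<comment> \<open>Inverses are used because (y^-1 x^-1)^-1 (x^-1 y^-1) is exactly the commutator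
    of \<open>x\<close> and \<open>y\<close>.\<close>
  have "commutator G u (inv y \<otimes> inv x) = commutator G u (inv y) \<otimes> commutator G u (inv x)"
    using central_commutator_mult[OF u] xy by simp
  also have "\<dots> = commutator G u (inv x) \<otimes> commutator G u (inv y)"
    using center_commute[OF u(2)[of "inv y"]] xy u commutator_closed by simp
  also have "\<dots> = commutator G u (inv x \<otimes> inv y)"
    using central_commutator_mult[OF u] xy by simp
  finally have "inv (inv y \<otimes> inv x) \<otimes> (inv x \<otimes> inv y) \<in> centralizer G u"
    using central_commutator_eq_iff[OF u] xy by simp
  then show "commutator G x y \<in> centralizer G u"
    using xy by (simp add: commutator_def inv_mult_group m_assoc)
qed

lemma card_central_commutators:
  assumes "finite (carrier G)"
    and u: "u \<in> carrier G" "\<And>g. g \<in> carrier G \<Longrightarrow> commutator G u g \<in> center G"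
    and S: "subgroup S G"
  shows "card S = card (S \<inter> centralizer G u) * card (commutator G u ` S)"
proof (rule card_subgroup_eq_card_fibre_times_card_image[OF assms(1) S])
  show "subgroup (S \<inter> centralizer G u) G"
    using subgroups_Inter_pair[OF S centralizer_subgroup[OF u(1)]] .
  fix x y assume xy: "x \<in> S" "y \<in> S"
  then have "inv x \<otimes> y \<in> S" using S by (simp add: subgroup.m_closed subgroup.m_inv_closed)
  then show "commutator G u x = commutator G u y \<longleftrightarrow> inv x \<otimes> y \<in> S \<inter> centralizer G u"
    using central_commutator_eq_iff[OF u, of x y] xy subgroup.mem_carrier[OF S] by simp
qed blast

end

section \<open>Commutators and centralizers under a homomorphism\<close>

context group_hom
begin

lemma vimage_subgroup:
  assumes "subgroup S H"
  shows "subgroup {g \<in> carrier G. h g \<in> S} G"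
  by (rule G.subgroupI)
    (use subgroup.one_closed[OF assms] subgroup.m_closed[OF assms] subgroup.m_inv_closed[OF assms]
      in \<open>auto intro!: exI[of _ "\<one>\<^bsub>G\<^esub>"]\<close>)

lemma commutator_hom:
  "\<lbrakk>x \<in> carrier G; y \<in> carrier G\<rbrakk> \<Longrightarrow> h (commutator G x y) = commutator H (h x) (h y)"
  by (simp add: commutator_def)

text \<open>Lets centralizers in a quotient be described, and counted, by subsets of
  \<open>G\<close>.\<close>

lemma in_centralizer_image_iff:
  assumes "x \<in> carrier G" "g \<in> carrier G"
  shows "h g \<in> centralizer H (h x) \<longleftrightarrow> commutator G x g \<in> kernel G H h"
  using assms H.commutator_eq_one_iff[of "h x" "h g"] commutator_hom[of x g] G.commutator_closed
  by (simp add: kernel_def)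

lemma commutator_vimage_subgroup:
  assumes x: "x \<in> carrier G"
  shows "subgroup {g \<in> carrier G. commutator G x g \<in> kernel G H h} G"
proof -
  have "{g \<in> carrier G. commutator G x g \<in> kernel G H h} = {g \<in> carrier G. h g \<in> centralizer H (h x)}"
    using in_centralizer_image_iff[OF x] by blast
  moreover have "subgroup {g \<in> carrier G. h g \<in> centralizer H (h x)} G"
    using H.centralizer_subgroup[OF hom_closed[OF x]] by (rule vimage_subgroup)
  ultimately show ?thesis by simp
qed

lemma card_derived_le:
  assumes fin: "finite (carrier G)" and surj: "h ` carrier G = carrier H"
  shows "card (derived G (carrier G)) \<le> card (kernel G H h) * card (derived H (carrier H))"
proof -
  have "derived H (carrier H) = h ` derived G (carrier G)"
    using derived_img[OF subset_refl] surj by simp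
  moreover have "derived G (carrier G) \<subseteq> carrier G" by (rule G.derived_in_carrier[OF subset_refl])
  ultimately have "derived G (carrier G) \<subseteq> {g \<in> carrier G. h g \<in> derived H (carrier H)}" by blast
  then have "card (derived G (carrier G)) \<le> card {g \<in> carrier G. h g \<in> derived H (carrier H)}"
    using fin by (intro card_mono) auto
  then show ?thesis
    using card_vimage[OF fin surj H.derived_in_carrier[OF subset_refl]] by simp
qed

end

text \<open>This set is the full preimage of the centralizer of xN in G/N.\<close>

lemma (in group) commutator_preimage_subgroup:
  assumes "N \<lhd> G" "x \<in> carrier G"
  shows "subgroup {g \<in> carrier G. commutator G x g \<in> N} G"
proof -
  obtain Q :: "'a monoid" and h where h: "group_hom G Q h" "h ` carrier G = carrier Q" "kernel G Q h = N"
    by (rule quotient_on_representatives[OF assms(1)])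
  then show ?thesis using group_hom.commutator_vimage_subgroup[OF h(1) assms(2)] by simp
qed

section \<open>The derived subgroup when a normal subgroup has cyclic quotient\<close>

context group
begin

text \<open>On the abelian group \<open>A\<close> the map a to [a, y] is an endomorphism. Its image
  is normal in \<open>G\<close>, and modulo this image \<open>y\<close> commutes with
  \<open>A\<close>, so the quotient is abelian.\<close>

lemma derived_subset_commutators_with_element:
  assumes A: "A \<lhd> G" and ab: "\<And>a b. a \<in> A \<Longrightarrow> b \<in> A \<Longrightarrow> a \<otimes> b = b \<otimes> a"
    and y: "y \<in> carrier G"
    and dec: "\<And>g. g \<in> carrier G \<Longrightarrow> \<exists>a \<in> A. \<exists>j::nat. g = a \<otimes> y [^] j"
  shows "derived G (carrier G) \<subseteq> (\<lambda>a. commutator G a y) ` A"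
proof -
  interpret A: normal A G by fact
  let ?D = "(\<lambda>a. commutator G a y) ` A"
  have AG: "\<And>a. a \<in> A \<Longrightarrow> a \<in> carrier G" using A.subset by blast
  \<comment> \<open>Written this way, the commutator is a product of two elements of
    \<open>A\<close>, so its factors can be permuted freely.\<close>
  have com: "commutator G a y = a \<otimes> (y \<otimes> inv a \<otimes> inv y)" if "a \<in> A" for a
    using that AG y by (simp add: commutator_def m_assoc)
  have cA: "y \<otimes> inv a \<otimes> inv y \<in> A" if "a \<in> A" for a
    using that y by (intro A.inv_op_closed2) auto
  have DA: "commutator G a y \<in> A" if "a \<in> A" for a using com[OF that] cA[OF that] that by simp
  have mult: "commutator G (a \<otimes> b) y = commutator G a y \<otimes> commutator G b y" if a: "a \<in> A" and b: "b \<in> A" for a b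
  proof -
    let ?a = "y \<otimes> inv a \<otimes> inv y" and ?b = "y \<otimes> inv b \<otimes> inv y"
    have G: "a \<in> carrier G" "b \<in> carrier G" using AG a b by auto
    have "?b \<otimes> ?a = y \<otimes> (inv b \<otimes> inv a) \<otimes> inv y"
      using G y by (simp add: m_assoc) (simp add: m_assoc[symmetric])
    then have "commutator G (a \<otimes> b) y = a \<otimes> b \<otimes> (?b \<otimes> ?a)"
      using com[of "a \<otimes> b"] a b G by (simp add: inv_mult_group)
    also have "\<dots> = a \<otimes> (b \<otimes> ?b) \<otimes> ?a" using G y by (simp add: m_assoc)
    also have "\<dots> = a \<otimes> ((b \<otimes> ?b) \<otimes> ?a)" using G y by (simp add: m_assoc)
    also have "(b \<otimes> ?b) \<otimes> ?a = ?a \<otimes> (b \<otimes> ?b)" using cA[OF a] cA[OF b] b by (intro ab) auto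
    also have "a \<otimes> (?a \<otimes> (b \<otimes> ?b)) = (a \<otimes> ?a) \<otimes> (b \<otimes> ?b)" using G y by (simp add: m_assoc)
    finally show ?thesis using com a b by simp
  qed
  have one: "commutator G \<one> y = \<one>" using y by (simp add: commutator_def)
  have D: "subgroup ?D G"
  proof (rule subgroupI)
    show "?D \<subseteq> carrier G" using AG y commutator_closed by blast
    fix d assume "d \<in> ?D"
    then obtain a where a: "a \<in> A" "d = commutator G a y" by blast
    have "commutator G (inv a) y \<otimes> d = \<one>" using mult[of "inv a" a] a AG one by simp
    then have "inv d = commutator G (inv a) y"
      using a AG y commutator_closed by (intro inv_equality) auto
    then show "inv d \<in> ?D" using a by blast
    fix e assume "e \<in> ?D"
    then obtain b where b: "b \<in> A" "e = commutator G b y" by blast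
    show "d \<otimes> e \<in> ?D" using mult[OF a(1) b(1)] a b by (auto intro!: image_eqI[of _ _ "a \<otimes> b"])
  qed (use A.one_closed in blast)
  have conj_y: "y \<otimes> d \<otimes> inv y \<in> ?D" if d: "d \<in> ?D" for d
  proof -
    obtain a where a: "a \<in> A" "d = commutator G a y" using d by blast
    have "y \<otimes> d \<otimes> inv y = commutator G (y \<otimes> a \<otimes> inv y) y"
      using a AG y by (simp add: commutator_def inv_mult_group m_assoc)
    then show ?thesis using A.inv_op_closed2[OF y a(1)] by blast
  qed
  have conj_pow: "y [^] (j::nat) \<otimes> d \<otimes> inv (y [^] j) \<in> ?D" if "d \<in> ?D" for d j
  proof (induction j)
    case 0
    then show ?case using that subgroup.mem_carrier[OF D that] by simp
  next
    case (Suc j)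
    have dG: "d \<in> carrier G" using subgroup.mem_carrier[OF D that] .
    have "y [^] Suc j \<otimes> d \<otimes> inv (y [^] Suc j) = y \<otimes> (y [^] j \<otimes> d \<otimes> inv (y [^] j)) \<otimes> inv y"
      using y dG nat_pow_Suc2[OF y, of j] by (simp add: inv_mult_group m_assoc del: nat_pow_Suc)
    then show ?case using conj_y[OF Suc.IH] by simp
  qed
  have "?D \<lhd> G"
  proof (rule normal_invI[OF D])
    fix g d assume g: "g \<in> carrier G" and d: "d \<in> ?D"
    obtain a j where aj: "a \<in> A" "g = a \<otimes> y [^] (j::nat)" using dec[OF g] by blast
    let ?e = "y [^] j \<otimes> d \<otimes> inv (y [^] j)"
    have e: "?e \<in> ?D" by (rule conj_pow[OF d])
    \<comment> \<open>Since the image lies in the abelian group \<open>A\<close>, conjugation by the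
      factor \<open>a\<close> is trivial on it, and only conjugation by powers of \<open>y\<close>
      matters.\<close>
    have "?D \<subseteq> A" using DA by (rule image_subsetI)
    then have eA: "?e \<in> A" using e by (rule subsetD)
    have dG: "d \<in> carrier G" using subgroup.mem_carrier[OF D d] .
    have "g \<otimes> d \<otimes> inv g = a \<otimes> ?e \<otimes> inv a"
      using aj AG[OF aj(1)] dG y by (simp add: inv_mult_group m_assoc)
    also have "a \<otimes> ?e = ?e \<otimes> a" using aj(1) eA by (rule ab)
    also have "?e \<otimes> a \<otimes> inv a = ?e" using AG[OF aj(1)] dG y by (simp add: m_assoc)
    finally show "g \<otimes> d \<otimes> inv g \<in> ?D" using e by simp
  qed
  then obtain Q :: "'a monoid" and h where h: "group_hom G Q h" "h ` carrier G = carrier Q" "kernel G Q h = ?D"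
    by (rule quotient_on_representatives)
  interpret h: group_hom G Q h by (rule h(1))
  \<comment> \<open>What commutes with the images of \<open>A\<close> and \<open>y\<close> is
    central in \<open>Q\<close>. This is applied to elements of \<open>A\<close>, then to
    \<open>y\<close>, and with these known to arbitrary elements.\<close>
  have cent: "centralizer Q (h x) = carrier Q"
    if x: "x \<in> carrier G" and "\<And>a. a \<in> A \<Longrightarrow> h a \<in> centralizer Q (h x)" "h y \<in> centralizer Q (h x)" for x
  proof -
    have "{g \<in> carrier G. h g \<in> centralizer Q (h x)} = carrier G"
      using that AG y dec h.vimage_subgroup[OF h.H.centralizer_subgroup[OF h.hom_closed[OF x]]]
      by (intro generated_by_coset_powers[of A y]) auto
    then have "h ` carrier G \<subseteq> centralizer Q (h x)" by blast
    then show ?thesis unfolding h(2) by (auto simp: centralizer_def)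
  qed
  have hcomm: "h y \<in> centralizer Q (h a)" if "a \<in> A" for a
    using that h.in_centralizer_image_iff[OF AG[OF that] y] h(3) by blast
  have cA: "centralizer Q (h a) = carrier Q" if "a \<in> A" for a
  proof (rule cent[OF AG[OF that]])
    fix b assume "b \<in> A"
    then have "h (b \<otimes> a) = h (a \<otimes> b)" using ab that by simp
    then show "h b \<in> centralizer Q (h a)" using that \<open>b \<in> A\<close> AG by (simp add: centralizer_def)
  qed (rule hcomm[OF that])
  have cy: "centralizer Q (h y) = carrier Q"
  proof (rule cent[OF y])
    fix a assume "a \<in> A"
    then show "h a \<in> centralizer Q (h y)"
      using h.H.centralizer_sym hcomm AG y by (metis h.hom_closed)
  qed (simp add: centralizer_def y)
  show ?thesis
  proof (rule derived_subset_if_commutators[OF D])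
    fix x g assume xg: "x \<in> carrier G" "g \<in> carrier G"
    have "centralizer Q (h x) = carrier Q"
    proof (rule cent[OF xg(1)])
      fix a assume "a \<in> A"
      then show "h a \<in> centralizer Q (h x)"
        using h.H.centralizer_sym[of "h a" "h x"] cA xg AG by auto
    next
      show "h y \<in> centralizer Q (h x)" using h.H.centralizer_sym[of "h y" "h x"] cy xg y by auto
    qed
    then have "h g \<in> centralizer Q (h x)" using xg by simp
    then show "commutator G x g \<in> ?D" using h.in_centralizer_image_iff[OF xg] h(3) by simp
  qed
qed

end

context finite_p_group
begin

text \<open>This is |G' : K'| <= |K : S| without division, where \<open>S\<close> consists of the
  elements of \<open>K\<close> commuting with \<open>y\<close> modulo K'. In G/K' the image of
  \<open>K\<close> is abelian, so every element of the derived subgroup is a single commutator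
  [k, y], and these commutators correspond to the cosets of \<open>S\<close> in
  \<open>K\<close>.\<close>

lemma card_derived_le_normal_subgroup_of_coset_powers:
  assumes K: "K \<lhd> G" and y: "y \<in> carrier G"
    and dec: "\<And>g. g \<in> carrier G \<Longrightarrow> \<exists>k \<in> K. \<exists>j::nat. g = k \<otimes> y [^] j"
  shows "card (derived G (carrier G)) * card {k \<in> K. commutator G y k \<in> derived G K}
    \<le> card (derived G K) * card K"
proof -
  have KG: "subgroup K G" using K by (rule normal_imp_subgroup)
  have KsG: "K \<subseteq> carrier G" using subgroup.subset[OF KG] .
  have dK: "derived G K \<lhd> G" by (rule derived_is_normal[OF K])
  obtain Q :: "'a monoid" and h where h: "group_hom G Q h" "h ` carrier G = carrier Q" "kernel G Q h = derived G K"
    by (rule quotient_on_representatives[OF dK])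
  interpret h: group_hom G Q h by (rule h(1))
  let ?S = "{k \<in> K. commutator G y k \<in> derived G K}"
  let ?f = "\<lambda>k. commutator Q (h k) (h y)"
  have abel: "h a \<otimes>\<^bsub>Q\<^esub> h b = h b \<otimes>\<^bsub>Q\<^esub> h a" if "a \<in> K" "b \<in> K" for a b
  proof -
    have "h b \<in> centralizer Q (h a)"
      using commutator_in_derived[OF that] h.in_centralizer_image_iff[of a b] that KsG h(3) by blast
    then show ?thesis by (simp add: centralizer_def)
  qed
  have S: "?S = K \<inter> {g \<in> carrier G. h g \<in> centralizer Q (h y)}"
    using h.in_centralizer_image_iff[OF y] KsG h(3) by blast
  have SG: "subgroup ?S G"
    unfolding S using subgroups_Inter_pair[OF KG
      h.vimage_subgroup[OF h.H.centralizer_subgroup[OF h.hom_closed[OF y]]]] .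
  have "card K = card ?S * card (?f ` K)"
  proof (rule card_subgroup_eq_card_fibre_times_card_image[OF fin KG SG])
    fix a b assume ab: "a \<in> K" "b \<in> K"
    let ?a = "h a" and ?b = "h b" and ?y = "h y" and ?d = "h (inv a \<otimes> b)"
    have G: "a \<in> carrier G" "b \<in> carrier G" using ab KsG by auto
    have dK: "inv a \<otimes> b \<in> K" using ab KG by (simp add: subgroup.m_closed subgroup.m_inv_closed)
    have Q: "?a \<in> carrier Q" "?b \<in> carrier Q" "?y \<in> carrier Q" "?d \<in> carrier Q"
      using G y by auto
    have bad: "?b = ?a \<otimes>\<^bsub>Q\<^esub> ?d"
    proof -
      have "b = a \<otimes> (inv a \<otimes> b)" using G by (simp add: m_assoc[symmetric])
      then show ?thesis using G by (metis h.hom_mult inv_closed m_closed)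
    qed
    have conjK: "y \<otimes> inv a \<otimes> inv y \<in> K"
      using normal_invE(2)[OF K y, of "inv a"] subgroup.m_inv_closed[OF KG ab(1)] by simp
    let ?c = "h (y \<otimes> inv a \<otimes> inv y)"
    have c: "?c \<in> carrier Q" "?c = ?y \<otimes>\<^bsub>Q\<^esub> inv\<^bsub>Q\<^esub> ?a \<otimes>\<^bsub>Q\<^esub> inv\<^bsub>Q\<^esub> ?y" using G y by auto
    \<comment> \<open>With b = ad in the quotient, [ad, y] = a [d, y] (y a^-1 y^-1) while [a, y] = a
      (y a^-1 y^-1); the two agree exactly when [d, y] = 1.\<close>
    have fa: "?f a = ?a \<otimes>\<^bsub>Q\<^esub> ?c" unfolding commutator_def c(2) using Q by (simp add: h.H.m_assoc)
    have "?f b = ?a \<otimes>\<^bsub>Q\<^esub> ?d \<otimes>\<^bsub>Q\<^esub> (?y \<otimes>\<^bsub>Q\<^esub> inv\<^bsub>Q\<^esub> ?d \<otimes>\<^bsub>Q\<^esub> inv\<^bsub>Q\<^esub> ?y) \<otimes>\<^bsub>Q\<^esub> ?c"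
      unfolding commutator_def c(2) bad using Q
      by (simp add: h.H.m_assoc h.H.inv_mult_group) (simp add: h.H.m_assoc[symmetric])
    also have "\<dots> = ?a \<otimes>\<^bsub>Q\<^esub> (?f (inv a \<otimes> b) \<otimes>\<^bsub>Q\<^esub> ?c)"
      unfolding commutator_def using Q c(1) by (simp add: h.H.m_assoc)
    finally have fb: "?f b = ?a \<otimes>\<^bsub>Q\<^esub> (?f (inv a \<otimes> b) \<otimes>\<^bsub>Q\<^esub> ?c)" .
    have fd: "?f (inv a \<otimes> b) \<in> carrier Q" using Q h.H.commutator_closed by blast
    have "?f a = ?f b \<longleftrightarrow> ?f (inv a \<otimes> b) = \<one>\<^bsub>Q\<^esub>"
      unfolding fa fb using Q c(1) fd by simp
    also have "\<dots> \<longleftrightarrow> ?y \<in> centralizer Q ?d" by (rule h.H.commutator_eq_one_iff[OF Q(4,3)])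
    also have "\<dots> \<longleftrightarrow> inv a \<otimes> b \<in> ?S"
      using h.H.centralizer_sym[OF Q(4,3)] dK KsG unfolding S by auto
    finally show "?f a = ?f b \<longleftrightarrow> inv a \<otimes> b \<in> ?S" .
  qed blast
  moreover have "derived Q (carrier Q) \<subseteq> (\<lambda>a. commutator Q a (h y)) ` (h ` K)"
  proof (rule h.H.derived_subset_commutators_with_element)
    show "h ` K \<lhd> Q"
    proof (rule h.H.normal_invI)
      show "subgroup (h ` K) Q" by (rule h.subgroup_img_is_subgroup[OF KG])
      fix x k assume "x \<in> carrier Q" "k \<in> h ` K"
      then obtain g a where ga: "g \<in> carrier G" "x = h g" "a \<in> K" "k = h a" using h(2) by blast
      then have "x \<otimes>\<^bsub>Q\<^esub> k \<otimes>\<^bsub>Q\<^esub> inv\<^bsub>Q\<^esub> x = h (g \<otimes> a \<otimes> inv g)" using KsG by auto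
      then show "x \<otimes>\<^bsub>Q\<^esub> k \<otimes>\<^bsub>Q\<^esub> inv\<^bsub>Q\<^esub> x \<in> h ` K" using normal_invE(2)[OF K ga(1,3)] by blast
    qed
    fix g assume "g \<in> carrier Q"
    then obtain g' where g': "g' \<in> carrier G" "g = h g'" using h(2) by blast
    obtain k j where kj: "k \<in> K" "g' = k \<otimes> y [^] (j::nat)" using dec[OF g'(1)] by blast
    then have "g = h k \<otimes>\<^bsub>Q\<^esub> h y [^]\<^bsub>Q\<^esub> j"
      using g'(2) subsetD[OF KsG kj(1)] y by (simp add: h.hom_nat_pow)
    then show "\<exists>a\<in>h ` K. \<exists>j::nat. g = a \<otimes>\<^bsub>Q\<^esub> h y [^]\<^bsub>Q\<^esub> j" using kj(1) by blast
  qed (use abel y in auto)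
  then have "card (derived Q (carrier Q)) \<le> card (?f ` K)"
    using card_mono[of "?f ` K"] finite_subgroup[OF KG] by (simp add: image_image)
  moreover have "card (derived G (carrier G)) \<le> card (derived G K) * card (derived Q (carrier Q))"
    using h.card_derived_le[OF fin h(2)] h(3) by simp
  ultimately have "card (derived G (carrier G)) \<le> card (derived G K) * card (?f ` K)"
    by (meson le_trans mult_le_mono2)
  then have "card (derived G (carrier G)) * card ?S \<le> card (derived G K) * card (?f ` K) * card ?S"
    by (rule mult_le_mono1)
  then show ?thesis using \<open>card K = card ?S * card (?f ` K)\<close> by (simp add: ac_simps)
qed

end

section \<open>The bound on the derived subgroup\<close>

text \<open>The set \<open>M\<close> plays the role of a proper subgroup containing all elements of breadth above \<open>m\<close>.\<close>

definition derived_bound :: "('a, 'b) monoid_scheme \<Rightarrow> nat \<Rightarrow> nat \<Rightarrow> bool" where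
  "derived_bound G p m \<longleftrightarrow>
    (\<forall>M. subgroup M G \<and> M \<noteq> carrier G \<and>
      (\<forall>x \<in> carrier G - M. card (carrier G) \<le> p ^ m * card (centralizer G x)) \<longrightarrow>
      card (derived G (carrier G)) \<le> p ^ (m * (m + 1) div 2))"

lemma triangle_Suc: "Suc e * (Suc e + 1) div 2 = e * (e + 1) div 2 + Suc e"
proof -
  have "Suc e * (Suc e + 1) = e * (e + 1) + Suc e * 2" by simp
  then show ?thesis by (simp only: div_mult_self1[OF zero_neq_numeral[symmetric]])
qed

context finite_p_group
begin

text \<open>Applies the bound to G/N and loses the factor |N|. As \<open>N\<close> lies in
  \<open>M\<close>, the image of \<open>M\<close> stays proper, and elements outside it come from
  elements outside \<open>M\<close>. The set in \<open>bound\<close> is the preimage of a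
  centralizer in G/N, so \<open>bound\<close> limits the breadth there.\<close>

lemma card_derived_le_via_quotient:
  assumes N: "N \<lhd> G" and M: "subgroup M G" "M \<noteq> carrier G" "N \<subseteq> M"
    and bound: "\<And>x. x \<in> carrier G - M \<Longrightarrow>
      card (carrier G) \<le> p ^ m * card {g \<in> carrier G. commutator G x g \<in> N}"
    and IH: "\<And>Q :: 'a monoid. finite_p_group Q p \<Longrightarrow> derived_bound Q p m"
  shows "card (derived G (carrier G)) \<le> card N * p ^ (m * (m + 1) div 2)"
proof -
  obtain Q :: "'a monoid" and h where h: "group_hom G Q h" "h ` carrier G = carrier Q" "kernel G Q h = N"
    by (rule quotient_on_representatives[OF N])
  interpret h: group_hom G Q h by (rule h(1))
  have Npos: "0 < card N" using card_subgroup_pos[OF normal_imp_subgroup[OF N]] .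
  have MG: "\<And>x. x \<in> M \<Longrightarrow> x \<in> carrier G" using subgroup.mem_carrier[OF M(1)] by blast
  have inM: "x \<in> M" if x: "x \<in> carrier G" "h x \<in> h ` M" for x
  proof -
    obtain k where k: "k \<in> M" "h x = h k" using x(2) by blast
    have "inv k \<otimes> x \<in> N" using k x(1) MG h(3) by (auto simp: kernel_def)
    then have "k \<otimes> (inv k \<otimes> x) \<in> M" using M(1,3) k(1) by (blast intro: subgroup.m_closed)
    then show ?thesis using MG[OF k(1)] x(1) by (simp add: m_assoc[symmetric])
  qed
  have "subgroup (h ` M) Q" by (rule h.subgroup_img_is_subgroup[OF M(1)])
  moreover have "h ` M \<noteq> carrier Q"
  proof
    assume "h ` M = carrier Q"
    then have "carrier G \<subseteq> M" using inM h.hom_closed by blast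
    then show False using M(2) MG by blast
  qed
  moreover have "card (carrier Q) \<le> p ^ m * card (centralizer Q q)" if q: "q \<in> carrier Q - h ` M" for q
  proof -
    obtain x where x: "x \<in> carrier G" "q = h x" using q h(2) by blast
    then have xM: "x \<in> carrier G - M" using q by blast
    have "{g \<in> carrier G. commutator G x g \<in> N} = {g \<in> carrier G. h g \<in> centralizer Q q}"
      using h.in_centralizer_image_iff[OF x(1)] x(2) h(3) by blast
    moreover have "centralizer Q q \<subseteq> carrier Q" by (auto simp: centralizer_def)
    ultimately have "card {g \<in> carrier G. commutator G x g \<in> N} = card N * card (centralizer Q q)"
      using h.card_vimage[OF fin h(2)] h(3) by simp
    moreover have "card (carrier G) = card N * card (carrier Q)"
    proof -
      have "{g \<in> carrier G. h g \<in> carrier Q} = carrier G" by auto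
      then show ?thesis using h.card_vimage[OF fin h(2) subset_refl] h(3) by simp
    qed
    ultimately have "card N * card (carrier Q) \<le> card N * (p ^ m * card (centralizer Q q))"
      using bound[OF xM] by (simp add: ac_simps)
    then show ?thesis using Npos by simp
  qed
  ultimately have "card (derived Q (carrier Q)) \<le> p ^ (m * (m + 1) div 2)"
    using IH[OF surjective_image_is_p_group[OF h(1,2)]] unfolding derived_bound_def by blast
  then show ?thesis
    using h.card_derived_le[OF fin h(2)] h(3) by (meson le_trans mult_le_mono2)
qed

text \<open>The main step. The third maximal subgroup \<open>K\<close> between \<open>ker \<mu> \<inter> ker \<kappa>\<close> and \<open>G\<close> avoids \<open>y\<close>, and
  none of its elements outside \<open>ker \<mu>\<close> commutes with \<open>u\<close>; hence their breadth drops in \<open>K / [u, S]\<close>.\<close>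

lemma card_derived_le_if_centralizer_subset:
  assumes \<mu>: "mod_character G p \<mu>"
    and bound: "\<And>x. x \<in> carrier G - mod_kernel G p \<mu> \<Longrightarrow> card (carrier G) \<le> p ^ m * card (centralizer G x)"
    and y: "y \<in> carrier G" "y \<notin> mod_kernel G p \<mu>"
    and u: "u \<in> carrier G" "u \<notin> center G" "\<And>g. g \<in> carrier G \<Longrightarrow> commutator G u g \<in> center G"
    and sub: "centralizer G y \<subseteq> centralizer G u"
    and IH: "\<And>(Q :: 'a monoid) m'. m' < m \<Longrightarrow> finite_p_group Q p \<Longrightarrow> derived_bound Q p m'"
  shows "card (derived G (carrier G)) \<le> p ^ (m * (m + 1) div 2)"
proof -
  let ?M = "mod_kernel G p \<mu>"
  have pG: "0 < card (carrier G)" using card_subgroup_pos[OF subgroup_self] .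
  have p1: "0 < p" using prime_gt_0_nat[OF prime_p] .
  have cu: "subgroup (centralizer G u) G" "centralizer G u \<noteq> carrier G"
    using centralizer_subgroup[OF u(1)] in_center_iff[OF u(1)] u(2) by auto
  have csub: "centralizer G x \<subseteq> carrier G" for x by (auto simp: centralizer_def)
  \<comment> \<open>For m = 0 the element \<open>y\<close> would be central, and with it
    \<open>u\<close>.\<close>
  obtain e where m: "m = Suc e"
  proof (cases m)
    case 0
    have "card (carrier G) \<le> card (centralizer G y)" using bound[of y] y 0 by simp
    then have "centralizer G y = carrier G" using card_seteq[OF fin csub] by blast
    then show thesis using sub cu csub by blast
  qed
  obtain \<kappa> where \<kappa>: "mod_character G p \<kappa>" "centralizer G u \<subseteq> mod_kernel G p \<kappa>"
    "mod_kernel G p \<kappa> \<noteq> carrier G"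
    by (rule mod_character_vanishing_on_proper_subgroup[OF cu])
  \<comment> \<open>On the kernel of the sum, \<open>\<kappa>\<close> is the negative of
    \<open>\<mu>\<close> modulo \<open>p\<close>. So an element of \<open>K\<close> outside the
    kernel of \<open>\<mu>\<close> is also outside that of \<open>\<kappa>\<close>, which contains
    C(u). As \<open>\<kappa>\<close> vanishes at \<open>y\<close> and \<open>\<mu>\<close> does not,
    \<open>y\<close> is not in \<open>K\<close>.\<close>
  define \<psi> where "\<psi> x = \<mu> x + \<kappa> x" for x
  have \<psi>: "mod_character G p \<psi>" unfolding \<psi>_def using \<mu> \<kappa>(1) by (rule mod_character_add)
  define K where "K = mod_kernel G p \<psi>"
  have K: "K \<lhd> G" unfolding K_def by (rule mod_kernel_normal[OF \<psi>])
  have KG: "subgroup K G" using K by (rule normal_imp_subgroup)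
  have KsG: "K \<subseteq> carrier G" using subgroup.subset[OF KG] .
  have MG: "subgroup ?M G" using mod_kernel_normal[OF \<mu>] by (rule normal_imp_subgroup)
  have \<kappa>y: "int p dvd \<kappa> y"
  proof -
    have "y \<in> centralizer G y" using y by (simp add: centralizer_def)
    then show ?thesis using sub \<kappa>(2) by (auto simp: mod_kernel_def)
  qed
  have yK: "y \<notin> K"
    using y \<kappa>y by (auto simp: K_def mod_kernel_def \<psi>_def dvd_add_left_iff)
  have dec: "\<exists>k \<in> K. \<exists>j::nat. g = k \<otimes> c [^] j" if g: "g \<in> carrier G" and c: "c \<in> carrier G" "c \<notin> K" for g c
  proof -
    have "inv c \<notin> K" using c subgroup.m_inv_closed[OF KG, of "inv c"] by auto
    then obtain j where j: "g \<otimes> inv c [^] (j::nat) \<in> K"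
      using mod_kernel_mult_pow[OF prime_p \<psi>, of "inv c" g] g c unfolding K_def by auto
    have "g = g \<otimes> inv c [^] j \<otimes> c [^] j" using g c by (simp add: m_assoc nat_pow_inv)
    then show ?thesis using j by blast
  qed
  define S where "S = {k \<in> K. commutator G y k \<in> derived G K}"
  have dKnormal: "derived G K \<lhd> G" by (rule derived_is_normal[OF K])
  have dK: "subgroup (derived G K) G" using dKnormal by (rule normal_imp_subgroup)
  have dKK: "derived G K \<subseteq> K" by (rule derived_incl[OF subset_refl KG])
  \<comment> \<open>K/K' is abelian and \<open>G\<close> is generated by \<open>K\<close> and
    \<open>c\<close>, so an element of \<open>K\<close> commuting modulo K' with a single
    \<open>c\<close> outside \<open>K\<close> is central modulo K'. In particular \<open>S\<close>
    does not depend on \<open>y\<close>.\<close>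
  have all: "commutator G k g \<in> derived G K"
    if k: "k \<in> K" and c: "c \<in> carrier G" "c \<notin> K" "commutator G k c \<in> derived G K" and g: "g \<in> carrier G" for k c g
  proof -
    have "{g \<in> carrier G. commutator G k g \<in> derived G K} = carrier G"
      using dec c k KsG commutator_in_derived[of k K]
      by (intro generated_by_coset_powers[of K c] commutator_preimage_subgroup[OF dKnormal]) auto
    then show ?thesis using g by blast
  qed
  have swap: "commutator G b a \<in> H" if "commutator G a b \<in> H" "subgroup H G" "a \<in> carrier G" "b \<in> carrier G" for a b H
    using subgroup.m_inv_closed[OF that(2,1)] inv_commutator[OF that(3,4)] by simp
  have SK: "S \<subseteq> K" by (auto simp: S_def)
  have SG: "subgroup S G"
  proof -
    have "S = K \<inter> {k \<in> carrier G. commutator G y k \<in> derived G K}" using KsG by (auto simp: S_def)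
    then show ?thesis
      using subgroups_Inter_pair[OF KG commutator_preimage_subgroup[OF dKnormal y(1)]] by simp
  qed
  define N where "N = commutator G u ` S"
  have N: "N \<lhd> G" unfolding N_def by (rule central_commutators_normal[OF u(1,3) SG])
  have NdK: "N \<subseteq> derived G K"
  proof
    fix n assume "n \<in> N"
    then obtain s where s: "s \<in> S" "n = commutator G u s" by (auto simp: N_def)
    have sK: "s \<in> K" "commutator G y s \<in> derived G K" using s(1) by (auto simp: S_def)
    have sG: "s \<in> carrier G" using sK(1) KsG by blast
    have "commutator G s u \<in> derived G K"
      using all[OF sK(1) y(1) yK swap[OF sK(2) dK y(1) sG] u(1)] .
    then show "n \<in> derived G K" using swap[OF _ dK sG u(1)] s(2) by simp
  qed
  have cardS: "card S = card (S \<inter> centralizer G u) * card N"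
    unfolding N_def by (rule card_central_commutators[OF fin u(1,3) SG])
  have prod: "card K \<le> p ^ m * card (K \<inter> centralizer G x)" if x: "x \<in> carrier G - ?M" for x
  proof -
    have c: "subgroup (centralizer G x) G" using centralizer_subgroup x by blast
    have "card K * card (centralizer G x) \<le> card (carrier G) * card (K \<inter> centralizer G x)"
      using KsG csub by (intro card_mult_le_card_Int_subgroups[OF fin KG c subgroup_self])
    also have "\<dots> \<le> p ^ m * card (centralizer G x) * card (K \<inter> centralizer G x)"
      using bound[OF x] by (rule mult_le_mono1)
    finally show ?thesis using card_subgroup_pos[OF c] by (simp add: ac_simps)
  qed
  have KN: "card K * card N \<le> p ^ m * card S"
  proof -
    have "K \<inter> centralizer G y \<subseteq> S \<inter> centralizer G u"
    proof
      fix k assume k: "k \<in> K \<inter> centralizer G y"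
      then have "commutator G y k = \<one>" using commutator_eq_one_iff[OF y(1)] KsG by blast
      then have "k \<in> S" using k subgroup.one_closed[OF dK] by (simp add: S_def)
      then show "k \<in> S \<inter> centralizer G u" using k sub by blast
    qed
    then have "card (K \<inter> centralizer G y) \<le> card (S \<inter> centralizer G u)"
      using finite_subgroup[OF SG] by (intro card_mono) auto
    then have "card K \<le> p ^ m * card (S \<inter> centralizer G u)"
      using prod[of y] y by (meson DiffI le_trans mult_le_mono2)
    then have "card K * card N \<le> p ^ m * card (S \<inter> centralizer G u) * card N" by (rule mult_le_mono1)
    then show ?thesis using cardS by (simp add: ac_simps)
  qed
  have drop: "card K \<le> p ^ e * card {k \<in> K. commutator G x k \<in> N}" if x: "x \<in> K" "x \<notin> ?M" for x
  proof -
    let ?T = "{k \<in> K. commutator G x k \<in> N}"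
    have xG: "x \<in> carrier G" using x KsG by blast
    have T: "subgroup ?T G"
    proof -
      have "?T = K \<inter> {k \<in> carrier G. commutator G x k \<in> N}" using KsG by auto
      then show ?thesis using subgroups_Inter_pair[OF KG commutator_preimage_subgroup[OF N xG]] by simp
    qed
    have cx: "subgroup (centralizer G x) G" by (rule centralizer_subgroup[OF xG])
    have KcT: "K \<inter> centralizer G x \<subseteq> ?T"
    proof
      fix k assume k: "k \<in> K \<inter> centralizer G x"
      then have "commutator G x k = \<one>" using commutator_eq_one_iff[OF xG] KsG by blast
      then show "k \<in> ?T" using k subgroup.one_closed[OF normal_imp_subgroup[OF N]] by simp
    qed
    \<comment> \<open>If C(x) lies in \<open>K\<close>, passing from \<open>G\<close> to
      \<open>K\<close> already divides the index by at least \<open>p\<close>. Otherwise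
      \<open>x\<close> commutes with some \<open>c\<close> outside \<open>K\<close>, hence is
      central modulo K' and lies in \<open>S\<close>; then [x, u] is in \<open>N\<close>, and the
      centralizer of \<open>x\<close> grows when \<open>N\<close> is factored out.\<close>
    have "p * card K \<le> p ^ m * card ?T"
    proof (cases "centralizer G x \<subseteq> K")
      case True
      have "K \<subset> carrier G" using KsG y yK by blast
      then have "p * card K \<le> card (carrier G)" by (rule card_proper_subgroup[OF KG subgroup_self])
      also have "\<dots> \<le> p ^ m * card (centralizer G x)" using bound xG x(2) by simp
      also have "\<dots> \<le> p ^ m * card ?T"
        using True KcT finite_subgroup[OF T] by (intro mult_le_mono2 card_mono) auto
      finally show ?thesis .
    next
      case False
      then obtain c where c: "c \<in> centralizer G x" "c \<notin> K" by blast
      have cG: "c \<in> carrier G" using c(1) csub by blast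
      have "commutator G x c = \<one>" using commutator_eq_one_iff[OF xG cG] c(1) by simp
      then have "commutator G x c \<in> derived G K" using subgroup.one_closed[OF dK] by simp
      then have "commutator G x y \<in> derived G K" using all[OF x(1) cG c(2)] y by blast
      then have xS: "x \<in> S" using swap[OF _ dK xG y(1)] x(1) by (simp add: S_def)
      then have "commutator G u x \<in> N" by (simp add: N_def)
      then have xu: "commutator G x u \<in> N" using swap[OF _ normal_imp_subgroup[OF N] u(1) xG] by blast
      \<comment> \<open>\<open>u\<close> itself may lie outside \<open>K\<close>. Removing a power
        of \<open>c\<close>, which commutes with \<open>x\<close>, gives an element of
        \<open>K\<close> with the same commutator with \<open>x\<close> as \<open>u\<close>.\<close>
      obtain k j where kj: "k \<in> K" "u = k \<otimes> c [^] (j::nat)" using dec[OF u(1) cG c(2)] by blast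
      have kG: "k \<in> carrier G" using kj KsG by blast
      have cj: "c [^] j \<in> centralizer G x"
        by (induction j) (use c(1) cx in \<open>auto intro: subgroup.one_closed subgroup.m_closed\<close>)
      have kT: "k \<in> ?T"
        using commutator_mult_centralizing[OF xG kG cj] kj xu by simp
      have "x \<notin> centralizer G u"
      proof
        assume "x \<in> centralizer G u"
        then have "int p dvd \<kappa> x" using \<kappa>(2) by (auto simp: mod_kernel_def)
        moreover have "int p dvd \<mu> x + \<kappa> x" using x(1) by (simp add: K_def mod_kernel_def \<psi>_def)
        ultimately show False using x(2) xG by (simp add: mod_kernel_def dvd_add_left_iff)
      qed
      then have "u \<notin> centralizer G x" using centralizer_sym[OF xG u(1)] by simp
      then have "k \<notin> centralizer G x" using kj(2) cj subgroup.m_closed[OF cx, of k "c [^] j"] by blast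
      then have "K \<inter> centralizer G x \<subset> ?T" using KcT kT by blast
      then have "p * card (K \<inter> centralizer G x) \<le> card ?T"
        by (rule card_proper_subgroup[OF subgroups_Inter_pair[OF KG cx] T])
      then have T': "p ^ m * (p * card (K \<inter> centralizer G x)) \<le> p ^ m * card ?T" by (rule mult_le_mono2)
      have "p * card K \<le> p * (p ^ m * card (K \<inter> centralizer G x))"
        using prod[of x] xG x(2) by (intro mult_le_mono2) simp
      also have "\<dots> = p ^ m * (p * card (K \<inter> centralizer G x))" by (rule mult.left_commute)
      finally show ?thesis using T' by (rule le_trans)
    qed
    then show ?thesis using p1 m by (simp add: ac_simps)
  qed
  let ?K = "G\<lparr>carrier := K\<rparr>"
  interpret K: finite_p_group ?K p by (rule subgroup_is_p_group[OF KG])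
  have comK: "commutator ?K a b = commutator G a b" if "a \<in> K" "b \<in> K" for a b
    using that m_inv_consistent[OF KG] by (simp add: commutator_def)
  have derK: "derived ?K K = derived G K" by (rule derived_consistent[OF subset_refl KG])
  have NM: "N \<subseteq> ?M"
    using NdK mono_derived[OF KsG] derived_subset_mod_kernel[OF \<mu>] by blast
  have "card (derived ?K (carrier ?K)) \<le> card N * p ^ (e * (e + 1) div 2)"
  proof (rule K.card_derived_le_via_quotient)
    show "N \<lhd> ?K"
      using normal_restrict_supergroup[OF KG N] NdK dKK by blast
    show "subgroup (K \<inter> ?M) ?K"
      using subgroups_Inter_pair[OF KG MG] KG by (intro subgroup_incl) auto
    show "N \<subseteq> K \<inter> ?M" using NM NdK dKK by blast
    show "K \<inter> ?M \<noteq> carrier ?K"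
    proof -
      \<comment> \<open>A witness in \<open>K\<close> outside the kernel of \<open>\<mu>\<close>:
        multiplying \<open>z\<close> by a power of \<open>y\<close> brings it into \<open>K\<close>
        without changing \<open>\<kappa>\<close> modulo \<open>p\<close>, and on \<open>K\<close>
        nonvanishing of \<open>\<kappa>\<close> and of \<open>\<mu>\<close> are equivalent.\<close>
      obtain z where z: "z \<in> carrier G" "\<not> int p dvd \<kappa> z"
        using \<kappa>(3) by (auto simp: mod_kernel_def)
      obtain j where j: "z \<otimes> y [^] (j::nat) \<in> K"
        using mod_kernel_mult_pow[OF prime_p \<psi> y(1) _ z(1)] yK unfolding K_def by blast
      have "int p dvd \<kappa> (y [^] j)"
      proof -
        have "int p dvd int j * \<kappa> y" using \<kappa>y by simp
        from dvd_add[OF mod_character_nat_pow[OF \<kappa>(1) y(1), of j] this] show ?thesis by simp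
      qed
      then have "\<not> int p dvd \<kappa> (z \<otimes> y [^] j)"
        using mod_character_mult_iff[OF \<kappa>(1) z(1) nat_pow_closed[OF y(1)], of j] z(2)
        by (simp add: dvd_add_left_iff)
      moreover have "int p dvd \<mu> (z \<otimes> y [^] j) + \<kappa> (z \<otimes> y [^] j)"
        using j by (simp add: K_def mod_kernel_def \<psi>_def)
      ultimately have "\<not> int p dvd \<mu> (z \<otimes> y [^] j)" by (metis dvd_add_right_iff)
      then show ?thesis using j by (auto simp: mod_kernel_def)
    qed
    show "card (carrier ?K) \<le> p ^ e * card {g \<in> carrier ?K. commutator ?K x g \<in> N}"
      if "x \<in> carrier ?K - K \<inter> ?M" for x
    proof -
      have "{g \<in> K. commutator ?K x g \<in> N} = {g \<in> K. commutator G x g \<in> N}"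
        using comK that by auto
      then show ?thesis using drop[of x] that by simp
    qed
  qed (use IH m in simp)
  then have "card (derived G K) \<le> card N * p ^ (e * (e + 1) div 2)" using derK by simp
  moreover have "card (derived G (carrier G)) * card S \<le> card (derived G K) * card K"
    unfolding S_def by (rule card_derived_le_normal_subgroup_of_coset_powers[OF K y(1)]) (rule dec[OF _ y(1) yK])
  \<comment> \<open>With all factors |S| cleared, the remaining chain bounds |G'| by the triangular
    power for \<open>e\<close> times |K : S| |N|. The latter is at most p^m, which is the step
    between consecutive triangular numbers.\<close>
  ultimately have "card (derived G (carrier G)) * card S \<le> card N * p ^ (e * (e + 1) div 2) * card K"
    by (meson le_trans mult_le_mono1)
  also have "\<dots> = p ^ (e * (e + 1) div 2) * (card K * card N)" by simp
  also have "\<dots> \<le> p ^ (e * (e + 1) div 2) * (p ^ m * card S)" using KN by (rule mult_le_mono2)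
  also have "\<dots> = p ^ (m * (m + 1) div 2) * card S"
    unfolding m triangle_Suc by (simp add: power_add ac_simps)
  finally show ?thesis using card_subgroup_pos[OF SG] by simp
qed

end

text \<open>The exponent obtained from |[u, G]| <= p^(2m-b-1) and the bound for \<open>b\<close> in
  the quotient. Equality holds at b = m - 1, so the saved factor \<open>p\<close> is
  essential.\<close>

lemma triangle_mono_add:
  fixes b m :: nat
  assumes "b < m"
  shows "2 * m - b - 1 + b * (b + 1) div 2 \<le> m * (m + 1) div 2"
  using assms
proof (induction m)
  case (Suc m)
  show ?case
  proof (cases "b = m")
    case True
    have "2 * Suc m - m - 1 = Suc m" by simp
    then show ?thesis unfolding True triangle_Suc by simp
  next
    case False
    then have "b < m" using Suc.prems by simp
    moreover from this have "2 * Suc m - b - 1 \<le> 2 * m - b - 1 + Suc m" by simp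
    ultimately show ?thesis using Suc.IH unfolding triangle_Suc by linarith
  qed
qed simp

section \<open>The search for the pair y and u, and the induction step\<close>

context finite_p_group
begin

text \<open>The image of \<open>D\<close> in the quotient by the center is a nontrivial normal
  subgroup, so it contains a nontrivial central element; \<open>u\<close> is a preimage of it in
  \<open>D\<close>.\<close>

lemma noncentral_normal_subgroup_meets_second_center:
  assumes D: "D \<lhd> G" and nc: "\<not> D \<subseteq> center G"
  obtains u where "u \<in> D" "u \<notin> center G" "\<And>g. g \<in> carrier G \<Longrightarrow> commutator G u g \<in> center G"
proof -
  obtain Q :: "'a monoid" and h where h: "group_hom G Q h" "h ` carrier G = carrier Q" "kernel G Q h = center G"
    by (rule quotient_on_representatives[OF center_normal])
  interpret h: group_hom G Q h by (rule h(1))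
  interpret Q: finite_p_group Q p by (rule surjective_image_is_p_group[OF h(1,2)])
  have DG: "subgroup D G" using D by (rule normal_imp_subgroup)
  have sub: "D \<subseteq> carrier G" using subgroup.subset[OF DG] .
  have "h ` D \<lhd> Q"
  proof (rule h.H.normal_invI)
    show "subgroup (h ` D) Q" by (rule h.subgroup_img_is_subgroup[OF DG])
    fix x k assume "x \<in> carrier Q" "k \<in> h ` D"
    then obtain g a where ga: "g \<in> carrier G" "x = h g" "a \<in> D" "k = h a" using h(2) by blast
    then have "x \<otimes>\<^bsub>Q\<^esub> k \<otimes>\<^bsub>Q\<^esub> inv\<^bsub>Q\<^esub> x = h (g \<otimes> a \<otimes> inv g)" using subsetD[OF sub ga(3)] by simp
    then show "x \<otimes>\<^bsub>Q\<^esub> k \<otimes>\<^bsub>Q\<^esub> inv\<^bsub>Q\<^esub> x \<in> h ` D" using normal_invE(2)[OF D ga(1,3)] by simp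
  qed
  moreover have "h ` D \<noteq> {\<one>\<^bsub>Q\<^esub>}"
  proof
    assume "h ` D = {\<one>\<^bsub>Q\<^esub>}"
    then have "D \<subseteq> kernel G Q h" using sub by (auto simp: kernel_def)
    then show False using nc h(3) by simp
  qed
  ultimately obtain z where z: "z \<in> h ` D" "z \<noteq> \<one>\<^bsub>Q\<^esub>" "z \<in> center Q"
    by (rule Q.normal_subgroup_meets_center)
  then obtain u where u: "u \<in> D" "z = h u" by blast
  have uG: "u \<in> carrier G" using u(1) sub by blast
  have "u \<notin> center G"
  proof
    assume "u \<in> center G"
    then have "u \<in> kernel G Q h" using h(3) by simp
    then show False using z(2) u(2) by (simp add: kernel_def)
  qed
  moreover have "commutator G u g \<in> center G" if "g \<in> carrier G" for g
  proof -
    have "h g \<in> centralizer Q (h u)"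
      using h.H.in_center_iff[of "h u"] z(3) u(2) uG that by simp
    then show ?thesis using h.in_centralizer_image_iff[OF uG that] h(3) by simp
  qed
  ultimately show thesis using that u(1) by blast
qed

text \<open>If \<open>C(x)\<close> is normal then so is \<open>C(C(x))\<close>, which contains \<open>x\<close> and hence meets the second center.\<close>

lemma exists_centralizer_subset_if_normal:
  assumes x: "x \<in> carrier G" "x \<notin> center G" and der: "derived G (carrier G) \<subseteq> centralizer G x"
  obtains u where "u \<in> carrier G" "u \<notin> center G" "\<And>g. g \<in> carrier G \<Longrightarrow> commutator G u g \<in> center G"
    "centralizer G x \<subseteq> centralizer G u"
proof -
  let ?C = "centralizer G x"
  \<comment> \<open>The centralizer of C(x), written so that membership is the inclusion required of
    \<open>u\<close>.\<close>
  define D where "D = {d \<in> carrier G. ?C \<subseteq> centralizer G d}"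
  have C: "subgroup ?C G" by (rule centralizer_subgroup[OF x(1)])
  have CG: "?C \<subseteq> carrier G" by (auto simp: centralizer_def)
  have D': "d \<in> D \<longleftrightarrow> d \<in> carrier G \<and> (\<forall>c \<in> ?C. d \<in> centralizer G c)" for d
  proof -
    have "c \<in> centralizer G d \<longleftrightarrow> d \<in> centralizer G c" if "d \<in> carrier G" "c \<in> ?C" for c
      using centralizer_sym[of c d] that CG by blast
    then show ?thesis unfolding D_def by blast
  qed
  \<comment> \<open>C(x) is normal because it contains G'.\<close>
  have conjC: "inv g \<otimes> c \<otimes> g \<in> ?C" if g: "g \<in> carrier G" and c: "c \<in> ?C" for g c
  proof -
    have cG: "c \<in> carrier G" using c CG by blast
    have "inv g \<otimes> c \<otimes> g = commutator G (inv g) c \<otimes> c"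
      using g cG by (simp add: commutator_def m_assoc)
    moreover have "commutator G (inv g) c \<in> ?C"
      using subsetD[OF der commutator_in_derived[OF inv_closed[OF g] cG]] .
    ultimately show ?thesis using subgroup.m_closed[OF C _ c] by simp
  qed
  have "D \<lhd> G"
  proof (rule normal_invI)
    show "subgroup D G"
    proof (rule subgroupI)
      show "D \<subseteq> carrier G" by (auto simp: D_def)
      show "D \<noteq> {}" using x(1) by (auto simp: D_def)
      fix a assume a: "a \<in> D"
      show "inv a \<in> D"
        using a D' centralizer_subgroup CG by (auto intro: subgroup.m_inv_closed)
      fix b assume b: "b \<in> D"
      show "a \<otimes> b \<in> D"
        using a b D' centralizer_subgroup CG by (auto intro: subgroup.m_closed)
    qed
    fix g d assume g: "g \<in> carrier G" and d: "d \<in> D"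
    have dG: "d \<in> carrier G" using d D' by blast
    have "g \<otimes> d \<otimes> inv g \<in> centralizer G c" if c: "c \<in> ?C" for c
    proof -
      let ?c = "inv g \<otimes> c \<otimes> g"
      have cG: "c \<in> carrier G" using c CG by blast
      have "d \<in> centralizer G ?c" using conjC[OF g c] d D' by blast
      then have dc: "d \<otimes> ?c = ?c \<otimes> d" by (simp add: centralizer_def)
      have "g \<otimes> d \<otimes> inv g \<otimes> c = g \<otimes> (d \<otimes> ?c) \<otimes> inv g" using g dG cG by (simp add: m_assoc)
      also have "\<dots> = g \<otimes> (?c \<otimes> d) \<otimes> inv g" by (simp only: dc)
      also have "\<dots> = c \<otimes> (g \<otimes> d \<otimes> inv g)"
        using g dG cG by (simp add: m_assoc[symmetric])
      finally show ?thesis using g dG by (simp add: centralizer_def)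
    qed
    then show "g \<otimes> d \<otimes> inv g \<in> D" using D' g dG by simp
  qed
  moreover have "\<not> D \<subseteq> center G" using x by (auto simp: D_def)
  ultimately obtain u where u: "u \<in> D" "u \<notin> center G" "\<And>g. g \<in> carrier G \<Longrightarrow> commutator G u g \<in> center G"
    by (rule noncentral_normal_subgroup_meets_second_center) blast
  then show thesis using that[of u] by (simp add: D_def)
qed

text \<open>Only the induction hypothesis is tied to \<open>'a monoid\<close>; \<open>G\<close> may
  have further record fields. Arguing by contradiction turns the preceding criterion into
  \<open>no_pair\<close>, which every unwanted case below violates.\<close>

lemma derived_bound_step:
  assumes IH: "\<And>(Q :: 'a monoid) m'. m' < m \<Longrightarrow> finite_p_group Q p \<Longrightarrow> derived_bound Q p m'"
  shows "derived_bound G p m"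
  unfolding derived_bound_def
proof (intro allI impI)
  fix M0 assume M0: "subgroup M0 G \<and> M0 \<noteq> carrier G \<and>
    (\<forall>x\<in>carrier G - M0. card (carrier G) \<le> p ^ m * card (centralizer G x))"
  \<comment> \<open>Enlarging \<open>M0\<close> to a maximal subgroup leaves fewer elements outside,
    so the breadth hypothesis survives.\<close>
  obtain \<mu> where \<mu>: "mod_character G p \<mu>" "M0 \<subseteq> mod_kernel G p \<mu>" "mod_kernel G p \<mu> \<noteq> carrier G"
    using mod_character_vanishing_on_proper_subgroup[of M0] M0 by blast
  define M where "M = mod_kernel G p \<mu>"
  have MG: "subgroup M G" unfolding M_def using mod_kernel_normal[OF \<mu>(1)] by (rule normal_imp_subgroup)
  have bound: "card (carrier G) \<le> p ^ m * card (centralizer G x)" if "x \<in> carrier G - M" for x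
    using M0 \<mu>(2) that unfolding M_def by blast
  have p1: "0 < p" using prime_gt_0_nat[OF prime_p] .
  have pG: "0 < card (carrier G)" using card_subgroup_pos[OF subgroup_self] .
  have csub: "centralizer G x \<subseteq> carrier G" for x by (auto simp: centralizer_def)
  note main = card_derived_le_if_centralizer_subset[OF \<mu>(1), folded M_def, OF bound, OF _ _ _ _ _ _ _ IH]
  let ?goal = "card (derived G (carrier G)) \<le> p ^ (m * (m + 1) div 2)"
  show ?goal
  proof (rule ccontr)
    assume neg: "\<not> ?goal"
    have no_pair: "\<not> centralizer G y \<subseteq> centralizer G u"
      if "y \<in> carrier G - M" "u \<in> carrier G" "u \<notin> center G"
        "\<And>g. g \<in> carrier G \<Longrightarrow> commutator G u g \<in> center G" for y u
      using main[of y u] neg that by blast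
    have "\<not> carrier G \<subseteq> center G"
    proof
      assume c: "carrier G \<subseteq> center G"
      have "derived G (carrier G) \<subseteq> {\<one>}"
      proof (rule derived_subset_if_commutators[OF triv_subgroup])
        fix x y assume "x \<in> carrier G" "y \<in> carrier G"
        moreover from this have "centralizer G x = carrier G" using in_center_iff c by blast
        ultimately show "commutator G x y \<in> {\<one>}" using commutator_eq_one_iff by simp
      qed
      then have "card (derived G (carrier G)) \<le> 1" using card_mono[of "{\<one>}"] by simp
      also have "\<dots> \<le> p ^ (m * (m + 1) div 2)" using p1 by simp
      finally show False using neg by simp
    qed
    then obtain u where u: "u \<in> carrier G" "u \<notin> center G"
      "\<And>g. g \<in> carrier G \<Longrightarrow> commutator G u g \<in> center G"
      by (rule noncentral_normal_subgroup_meets_second_center[OF normal_self]) blast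
    \<comment> \<open>Outside \<open>M\<close>, the element \<open>u\<close> would form a forbidden
      pair with itself.\<close>
    have uM: "u \<in> M" using no_pair[of u u] u by blast
    define B where "B = commutator G u ` carrier G"
    have B: "B \<lhd> G" unfolding B_def by (rule central_commutators_normal[OF u(1,3) subgroup_self])
    have BG: "subgroup B G" using B by (rule normal_imp_subgroup)
    have "carrier G \<inter> centralizer G u = centralizer G u" using csub by blast
    then have cardB: "card (carrier G) = card (centralizer G u) * card B"
      using card_central_commutators[OF fin u(1,3) subgroup_self] unfolding B_def by simp
    have BM: "B \<subseteq> M"
    proof -
      have "B \<subseteq> derived G (carrier G)" unfolding B_def using commutator_in_derived[OF u(1)] by blast
      then show ?thesis using derived_subset_mod_kernel[OF \<mu>(1)] unfolding M_def by blast
    qed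
    define P where "P x = {g \<in> carrier G. commutator G x g \<in> B}" for x
    have P: "subgroup (P x) G" if "x \<in> carrier G" for x
      unfolding P_def by (rule commutator_preimage_subgroup[OF B that])
    have CP: "centralizer G x \<subseteq> P x" if "x \<in> carrier G" for x
    proof
      fix g assume g: "g \<in> centralizer G x"
      then have "commutator G x g = \<one>" using commutator_eq_one_iff[OF that] csub by blast
      then show "g \<in> P x" using g csub subgroup.one_closed[OF BG] by (auto simp: P_def)
    qed
    \<comment> \<open>As P(x) is the preimage of a centralizer in G/B, p^b is the largest class size
      in G/B of an element outside \<open>M\<close>. It is attained because all indices are powers
      of \<open>p\<close>: one exceeding p^(b-1) is at least p^b.\<close>
    define b where "b = (LEAST b. \<forall>x \<in> carrier G - M. card (carrier G) \<le> p ^ b * card (P x))"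
    have Pm: "\<forall>x \<in> carrier G - M. card (carrier G) \<le> p ^ m * card (P x)"
    proof
      fix x assume x: "x \<in> carrier G - M"
      then have "card (centralizer G x) \<le> card (P x)"
        using CP finite_subgroup[OF P] by (intro card_mono) auto
      then show "card (carrier G) \<le> p ^ m * card (P x)" using bound[OF x] by (meson le_trans mult_le_mono2)
    qed
    have bm: "b \<le> m" unfolding b_def using Pm by (rule Least_le)
    have Pb: "card (carrier G) \<le> p ^ b * card (P x)" if "x \<in> carrier G - M" for x
      using LeastI[of "\<lambda>b. \<forall>x \<in> carrier G - M. card (carrier G) \<le> p ^ b * card (P x)", OF Pm] that
      unfolding b_def by blast
    obtain x where x: "x \<in> carrier G" "x \<notin> M" "p ^ b * card (P x) \<le> card (carrier G)"
    proof (cases b)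
      case 0
      obtain x where x: "x \<in> carrier G" "x \<notin> M"
        using \<mu>(3) subgroup.subset[OF MG] unfolding M_def by blast
      have "card (P x) \<le> card (carrier G)" using fin by (intro card_mono) (auto simp: P_def)
      then show thesis using that x 0 by simp
    next
      case (Suc b')
      have "\<not> (\<forall>x \<in> carrier G - M. card (carrier G) \<le> p ^ b' * card (P x))"
        using not_less_Least[of b' "\<lambda>b. \<forall>x \<in> carrier G - M. card (carrier G) \<le> p ^ b * card (P x)"] Suc
        unfolding b_def[symmetric] by simp
      then obtain x where x: "x \<in> carrier G" "x \<notin> M" "p ^ b' * card (P x) < card (carrier G)" by auto
      obtain i where i: "card (P x) = p ^ i" by (rule card_subgroup_power[OF P[OF x(1)]])
      obtain k where k: "card (carrier G) = p ^ k" using card_power by blast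
      have "p ^ (b' + i) < p ^ k" using x(3) i k by (simp add: power_add)
      then have "b' + i < k" using prime_gt_1_nat[OF prime_p] by simp
      then have "p ^ (Suc b' + i) \<le> p ^ k" using p1 by (intro power_increasing) auto
      then have "p ^ b * card (P x) \<le> card (carrier G)" using i k Suc by (simp add: power_add)
      then show thesis using that x by blast
    qed
    \<comment> \<open>An element commuting with both \<open>x\<close> and
      \<open>x \<otimes> u\<close> commutes with \<open>u\<close>. Modulo \<open>B\<close> the
      element \<open>u\<close> is central, so both centralizers lie in \<open>P x\<close>.\<close>
    let ?v = "x \<otimes> u"
    let ?C = "centralizer G x" and ?C' = "centralizer G (x \<otimes> u)"
    have v: "?v \<in> carrier G" "?v \<notin> M"
    proof -
      show "?v \<in> carrier G" using x u by simp
      have "x = ?v \<otimes> inv u" using x u by (simp add: m_assoc)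
      then show "?v \<notin> M"
        using x(2) subgroup.m_closed[OF MG] subgroup.m_inv_closed[OF MG uM] by metis
    qed
    have C: "subgroup ?C G" "subgroup ?C' G" using centralizer_subgroup x v by auto
    have CCu: "?C \<inter> ?C' \<subseteq> centralizer G u"
    proof
      fix g assume g: "g \<in> ?C \<inter> ?C'"
      then have gG: "g \<in> carrier G" and gx: "g \<otimes> x = x \<otimes> g" and gv: "g \<otimes> (x \<otimes> u) = x \<otimes> u \<otimes> g"
        by (auto simp: centralizer_def)
      have "x \<otimes> (g \<otimes> u) = x \<otimes> g \<otimes> u" using gG x(1) u(1) by (simp add: m_assoc)
      also have "\<dots> = g \<otimes> x \<otimes> u" by (simp only: gx)
      also have "\<dots> = x \<otimes> u \<otimes> g" using gv gG x(1) u(1) by (simp only: m_assoc)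
      also have "\<dots> = x \<otimes> (u \<otimes> g)" using gG x(1) u(1) by (simp add: m_assoc)
      finally have "g \<otimes> u = u \<otimes> g" using gG x(1) u(1) by simp
      then show "g \<in> centralizer G u" using gG by (simp add: centralizer_def)
    qed
    have C'P: "?C' \<subseteq> P x"
    proof
      fix g assume g: "g \<in> ?C'"
      obtain Q :: "'a monoid" and h where h: "group_hom G Q h" "h ` carrier G = carrier Q" "kernel G Q h = B"
        by (rule quotient_on_representatives[OF B])
      interpret h: group_hom G Q h by (rule h(1))
      have gG: "g \<in> carrier G" and "g \<otimes> ?v = ?v \<otimes> g" using g by (auto simp: centralizer_def)
      then have "h (g \<otimes> (x \<otimes> u)) = h (x \<otimes> u \<otimes> g)" by simp
      then have eq: "h g \<otimes>\<^bsub>Q\<^esub> h x \<otimes>\<^bsub>Q\<^esub> h u = h x \<otimes>\<^bsub>Q\<^esub> (h u \<otimes>\<^bsub>Q\<^esub> h g)"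
        using gG x(1) u(1) by (simp add: h.H.m_assoc)
      have "commutator G u g \<in> B" using gG by (simp add: B_def)
      then have "h g \<in> centralizer Q (h u)" using h.in_centralizer_image_iff[OF u(1) gG] h(3) by simp
      then have "h u \<otimes>\<^bsub>Q\<^esub> h g = h g \<otimes>\<^bsub>Q\<^esub> h u" by (simp add: centralizer_def)
      then have "h g \<otimes>\<^bsub>Q\<^esub> h x \<otimes>\<^bsub>Q\<^esub> h u = h x \<otimes>\<^bsub>Q\<^esub> h g \<otimes>\<^bsub>Q\<^esub> h u"
        using eq gG x(1) u(1) by (simp add: h.H.m_assoc)
      then have "h g \<otimes>\<^bsub>Q\<^esub> h x = h x \<otimes>\<^bsub>Q\<^esub> h g" using gG x(1) u(1) by simp
      then have "h g \<in> centralizer Q (h x)" using gG by (simp add: centralizer_def)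
      then show "g \<in> P x" using h.in_centralizer_image_iff[OF x(1) gG] h(3) gG by (simp add: P_def)
    qed
    define d where "d = card (?C \<inter> ?C')"
    \<comment> \<open>both centralizers lie in \<open>P x\<close>, of index \<open>p ^ b\<close>, and their indices in \<open>G\<close> are at most \<open>p ^ m\<close>\<close>
    have gd: "p ^ b * card (carrier G) \<le> p ^ (2 * m) * d"
    proof -
      let ?g = "card (carrier G)"
      have "?g * ?g \<le> (p ^ m * card ?C) * (p ^ m * card ?C')"
        using bound x v by (intro mult_le_mono) auto
      also have "\<dots> = p ^ (2 * m) * (card ?C * card ?C')" by (simp add: mult_2 mult_2_right power_add ac_simps)
      also have "\<dots> \<le> p ^ (2 * m) * (card (P x) * d)"
        unfolding d_def using CP[OF x(1)] C'P
        by (intro mult_le_mono2 card_mult_le_card_Int_subgroups[OF fin C P[OF x(1)]])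
      finally have "p ^ b * (?g * ?g) \<le> p ^ b * (p ^ (2 * m) * (card (P x) * d))" by (rule mult_le_mono2)
      also have "\<dots> = p ^ (2 * m) * d * (p ^ b * card (P x))" by (simp add: ac_simps)
      also have "\<dots> \<le> p ^ (2 * m) * d * ?g" using x(3) by (rule mult_le_mono2)
      finally have "?g * (p ^ b * ?g) \<le> ?g * (p ^ (2 * m) * d)" by (simp add: ac_simps)
      then show ?thesis using pG by simp
    qed
    \<comment> \<open>If b = m, then \<open>gd\<close> makes the intersection as large as
      \<open>P x\<close>. Hence C(x) equals the intersection and lies in C(u), a forbidden
      pair.\<close>
    have "b < m"
    proof (rule ccontr)
      assume "\<not> b < m"
      then have "b = m" using bm by simp
      then have "p ^ m * card (carrier G) \<le> p ^ m * (p ^ m * d)" using gd by (simp add: mult_2 mult_2_right power_add ac_simps)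
      then have "card (carrier G) \<le> p ^ m * d" using p1 by simp
      with x(3) have "p ^ m * card (P x) \<le> p ^ m * d" unfolding \<open>b = m\<close> by (rule le_trans)
      then have "card (P x) \<le> d" using p1 by simp
      moreover have "card ?C \<le> card (P x)" using CP[OF x(1)] finite_subgroup[OF P[OF x(1)]] by (rule card_mono[rotated])
      ultimately have "card ?C \<le> card (?C \<inter> ?C')" by (simp add: d_def)
      then have "?C \<inter> ?C' = ?C" using finite_subgroup[OF C(1)] by (intro card_seteq) auto
      then have "?C \<subseteq> centralizer G u" using CCu by blast
      then show False using no_pair[of x u] x u by blast
    qed
    \<comment> \<open>Equality would give C(u) <= C(x). For central \<open>x\<close> the pair
      \<open>x \<otimes> u\<close>, \<open>u\<close> is then forbidden. Otherwise C(x) contains C(u)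
      and so G', and the normal case yields a forbidden partner for \<open>x\<close>.\<close>
    have strict: "?C \<inter> ?C' \<subset> centralizer G u"
    proof (rule ccontr)
      assume "\<not> ?C \<inter> ?C' \<subset> centralizer G u"
      then have uC: "centralizer G u \<subseteq> ?C" using CCu by blast
      show False
      proof (cases "x \<in> center G")
        case True
        then have "?C = carrier G" using in_center_iff[OF x(1)] by simp
        then have "?C' \<subseteq> centralizer G u" using CCu csub by blast
        then show False using no_pair[of ?v u] v u by blast
      next
        case False
        have "derived G (carrier G) \<subseteq> ?C" using derived_subset_centralizer[OF u(1,3)] uC by blast
        then obtain u' where "u' \<in> carrier G" "u' \<notin> center G"
          "\<And>g. g \<in> carrier G \<Longrightarrow> commutator G u' g \<in> center G" "?C \<subseteq> centralizer G u'"
          by (rule exists_centralizer_subset_if_normal[OF x(1) False]) blast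
        then show False using no_pair[of x u'] x by blast
      qed
    qed
    \<comment> \<open>|B| is the index of C(u). The strict inclusion improves the bound p^(2m-b)
      from \<open>gd\<close> by one factor \<open>p\<close>.\<close>
    have cardB_le: "card B \<le> p ^ (2 * m - b - 1)"
    proof -
      have cu: "subgroup (centralizer G u) G" by (rule centralizer_subgroup[OF u(1)])
      have "p * d \<le> card (centralizer G u)"
        unfolding d_def by (rule card_proper_subgroup[OF subgroups_Inter_pair[OF C] cu strict])
      then have "p ^ Suc b * (d * card B) \<le> p ^ b * (card (centralizer G u) * card B)"
        by (simp add: mult_le_mono1 flip: mult.assoc)
      also have "\<dots> \<le> p ^ (2 * m) * d" using gd cardB by simp
      also have "p ^ (2 * m) = p ^ Suc b * p ^ (2 * m - b - 1)"
      proof -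
        have "2 * m = Suc b + (2 * m - b - 1)" using \<open>b < m\<close> by simp
        from arg_cong[OF this, of "\<lambda>k. p ^ k"] show ?thesis by (simp only: power_add)
      qed
      finally have "(p ^ Suc b * d) * card B \<le> (p ^ Suc b * d) * p ^ (2 * m - b - 1)" by (simp add: ac_simps)
      moreover have "0 < d" unfolding d_def by (rule card_subgroup_pos[OF subgroups_Inter_pair[OF C]])
      ultimately show ?thesis using p1 by simp
    qed
    have "card (derived G (carrier G)) \<le> card B * p ^ (b * (b + 1) div 2)"
    proof (rule card_derived_le_via_quotient[OF B MG _ BM])
      show "M \<noteq> carrier G" using \<mu>(3) by (simp add: M_def)
    qed (use Pb IH \<open>b < m\<close> in \<open>auto simp: P_def\<close>)
    also have "\<dots> \<le> p ^ (2 * m - b - 1) * p ^ (b * (b + 1) div 2)" using cardB_le by (rule mult_le_mono1)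
    also have "\<dots> = p ^ (2 * m - b - 1 + b * (b + 1) div 2)" by (simp only: power_add)
    also have "\<dots> \<le> p ^ (m * (m + 1) div 2)"
      using p1 triangle_mono_add[OF \<open>b < m\<close>] by (intro power_increasing) auto
    finally show False using neg by simp
  qed
qed

end

section \<open>The strong induction and the passage to breadths\<close>

lemma derived_bound_monoid:
  fixes G :: "'a monoid"
  assumes "finite_p_group G p"
  shows "derived_bound G p m"
  using assms
proof (induction m arbitrary: G rule: less_induct)
  case (less m)
  show ?case
    by (rule finite_p_group.derived_bound_step[OF less.prems]) (rule less.IH)
qed

text \<open>One further use of the induction step carries the result from \<open>'a monoid\<close>
  to arbitrary group records.\<close>

lemma (in finite_p_group) card_derived_le_if_breadth_bounded_outside:
  assumes "subgroup M G" "M \<noteq> carrier G"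
    and "\<And>x. x \<in> carrier G - M \<Longrightarrow> card (carrier G) \<le> p ^ m * card (centralizer G x)"
  shows "card (derived G (carrier G)) \<le> p ^ (m * (m + 1) div 2)"
  using derived_bound_step[OF derived_bound_monoid] assms unfolding derived_bound_def by blast

text \<open>The description in \<open>breadth\<close> is proper: by Lagrange the index of the
  centralizer is a power of \<open>p\<close>, and its exponent is unique since p > 1.\<close>

lemma (in finite_p_group) card_eq_power_breadth:
  assumes x: "x \<in> carrier G"
  shows "card (carrier G) = p ^ breadth G p x * card (centralizer G x)"
proof -
  have C: "subgroup (centralizer G x) G" by (rule centralizer_subgroup[OF x])
  have C0: "0 < card (centralizer G x)" by (rule card_subgroup_pos[OF C])
  obtain k where k: "card (carrier G) = p ^ k" using card_power by blast
  have "card (rcosets (centralizer G x)) * card (centralizer G x) = card (carrier G)"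
    using lagrange[OF C] by (simp add: order_def)
  moreover from this have "card (rcosets (centralizer G x)) dvd p ^ k" using k by (metis dvd_triv_left)
  ultimately obtain b where b: "card (carrier G) = p ^ b * card (centralizer G x)"
    using divides_primepow_nat[OF prime_p] by metis
  show ?thesis
    unfolding breadth_def
  proof (rule theI)
    fix c assume "card (carrier G) = p ^ c * card (centralizer G x)"
    then have "p ^ c = p ^ b" using b C0 by simp
    then show "c = b" using prime_gt_1_nat[OF prime_p] by simp
  qed (rule b)
qed

theorem theorem1p1:
  fixes G (structure) and p n :: nat
  assumes "Factorial_Ring.prime p" and "group G" and "finite (carrier G)"
    and "\<exists>k. card (carrier G) = p ^ k"
    and "card (derived G (carrier G)) > p ^ (n * (n - 1) div 2)"
  shows "generate G {x \<in> carrier G. breadth G p x \<ge> n} = carrier G"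
proof -
  interpret finite_p_group G p
    using assms(1-4) by (simp add: finite_p_group_def finite_p_group_axioms_def)
  let ?B = "{x \<in> carrier G. breadth G p x \<ge> n}"
  have M: "subgroup (generate G ?B) G" by (rule generate_is_subgroup) blast
  have inM: "\<And>x. x \<in> ?B \<Longrightarrow> x \<in> generate G ?B" by (rule generate.incl)
  show ?thesis
  proof (cases n)
    case 0
    then have "carrier G \<subseteq> generate G ?B" using inM by auto
    then show ?thesis using subgroup.subset[OF M] by blast
  next
    case (Suc m)
    show ?thesis
    proof (rule ccontr)
      assume ne: "generate G ?B \<noteq> carrier G"
      \<comment> \<open>The generated subgroup serves as \<open>M\<close>. With n = m + 1, breadth
        below \<open>n\<close> means breadth at most \<open>m\<close>, and m(m+1)/2 is the exponent
        n(n-1)/2 of the hypothesis.\<close>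
      have "card (derived G (carrier G)) \<le> p ^ (m * (m + 1) div 2)"
      proof (rule card_derived_le_if_breadth_bounded_outside[OF M ne])
        fix x assume x: "x \<in> carrier G - generate G ?B"
        then have "\<not> n \<le> breadth G p x" using inM[of x] by blast
        then have "breadth G p x \<le> m" using Suc by simp
        then have "p ^ breadth G p x \<le> p ^ m"
          using prime_gt_0_nat[OF prime_p] by (intro power_increasing) auto
        then show "card (carrier G) \<le> p ^ m * card (centralizer G x)"
          using card_eq_power_breadth[of x] x by (metis DiffD1 mult_le_mono1)
      qed
      then show False using assms(5) Suc by (simp add: mult.commute)
    qed
  qed
qed

end
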